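(* Let $(K_n)_{n=1}^\infty$ be the optimal constants satisfying the multilinear Bohnenblust--Hille inequality for real scalars, and let $\gamma$ be the Euler--Mascheroni constant. For any $\varepsilon>0$, $$K_{n+1}-K_{n}<\left( 2\sqrt{2}-4e^{\frac{1}{2}\gamma-1}\right) n^{\log_{2}\left( 2^{-3/2}e^{1-\frac{1}{2}\gamma}\right)+\varepsilon}$$ for infinitely many positive integers $n$.
   Context: For a positive integer $n$, $K_n$ denotes the optimal constant in the real $n$-linear Bohnenblust--Hille inequality, i.e. the smallest $C\in[1,\infty)$ such that $$\left(\sum_{i_1,\ldots,i_n=1}^N |U(e_{i_1},\ldots,e_{i_n})|^{\frac{2n}{n+1}}\right)^{\frac{n+1}{2n}}\le C\,\sup|U(z_1,\ldots,z_n)|$$ for all positive integers $N$ and all $n$-linear forms $U:\mathbb{R}^N\times\cdots\times\mathbb{R}^N\to\mathbb{R}$, where $(e_i)_{i=1}^N$ is the canonical basis of $\mathbb{R}^N$ and the supremum is over all $z_1,\ldots,z_n$ in the open unit ball of $\mathbb{R}^N$ with the sup norm. Such finite constants exist (Bohnenblust--Hille theorem). The Euler--Mascheroni constant is $\gamma=\lim_{m\to\infty}\left(-\log m+\sum_{k=1}^m \frac1k\right)\approx0.5772$. *)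

theory Defs
  imports "HOL-Analysis.Harmonic_Numbers" "HOL-Library.FuncSet" "Jordan_Normal_Form.Matrix"
begin

text \<open>
  The space \<open>\<real>\<^sup>N\<close> is \<^term>\<open>carrier_vec N\<close>, with coordinates and canonical basis indexed
  from \<open>0\<close> to \<open>N - 1\<close>. An \<open>n\<close>-tuple over a set \<open>A\<close> is an extensional function
  in \<open>{..<n} \<rightarrow>\<^sub>E A\<close>, so that an \<open>n\<close>-linear form has no arguments other than its \<open>n\<close> slots;
  its values off these tuples play no role.
\<close>

definition multilinear_form :: "nat \<Rightarrow> nat \<Rightarrow> ((nat \<Rightarrow> real vec) \<Rightarrow> real) \<Rightarrow> bool" where
  "multilinear_form n N U \<longleftrightarrow>
    (\<forall>z \<in> {..<n} \<rightarrow>\<^sub>E carrier_vec N. \<forall>k<n. \<forall>v \<in> carrier_vec N.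
      (\<forall>w \<in> carrier_vec N. U (z(k := v + w)) = U (z(k := v)) + U (z(k := w))) \<and>
      (\<forall>a. U (z(k := a \<cdot>\<^sub>v v)) = a * U (z(k := v))))"

text \<open>The maximum is meaningful only in positive dimension, the only case used below.\<close>

definition sup_norm :: "real vec \<Rightarrow> real" where
  "sup_norm v = Max ((\<lambda>i. \<bar>vec_index v i\<bar>) ` {..<dim_vec v})"

definition open_unit_ball :: "nat \<Rightarrow> real vec set" where
  "open_unit_ball N = {v \<in> carrier_vec N. sup_norm v < 1}"

text \<open>
  The supremum on the right-hand side is over a nonempty set that is bounded because
  \<open>U\<close> is multilinear on a finite-dimensional space, so the real-valued \<open>SUP\<close> is the true one.
\<close>

definition BH_inequality :: "nat \<Rightarrow> real \<Rightarrow> bool" where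
  "BH_inequality n C \<longleftrightarrow>
    (\<forall>N\<ge>1. \<forall>U. multilinear_form n N U \<longrightarrow>
      (\<Sum>i \<in> {..<n} \<rightarrow>\<^sub>E {..<N}.
          \<bar>U (\<lambda>k\<in>{..<n}. unit_vec N (i k))\<bar> powr (2 * real n / (real n + 1)))
        powr ((real n + 1) / (2 * real n))
      \<le> C * (SUP z \<in> {..<n} \<rightarrow>\<^sub>E open_unit_ball N. \<bar>U z\<bar>))"

definition BH_constant :: "nat \<Rightarrow> real" where
  "BH_constant n = (LEAST C. 1 \<le> C \<and> BH_inequality n C)"

end

theory Submission
  imports Defs "HOL-Probability.Distributions" "HOL-Real_Asymp.Real_Asymp"
begin

text \<open>
  The exponent of \<open>n\<close> in the theorem is larger than \<open>- 1 / 2\<close>, and the coefficient is positive. If the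
  inequality failed for all large \<open>n\<close>, the increments of the constants would be at least of order
  \<open>n powr s\<close> with \<open>s > - 1 / 2\<close>, and the constants themselves would grow faster than \<open>sqrt n\<close>
  (\<open>frequently_small_increment\<close>). So it suffices to prove that the optimal constants are bounded by a
  multiple of \<open>sqrt n\<close> (\<open>BH_constant_growth\<close>).

  This bound comes from the passage from \<open>n\<close> to \<open>n + 1\<close> slots: by Khinchine's inequality in one slot,
  the known inequality in the others, and interpolation over the choice of the slot
  (\<open>Blei_interpolation\<close>), the constant is multiplied by at most the Khinchine constant for the exponent
  \<open>2n / (n + 1)\<close> (\<open>BH_on_sign_vectors\<close>). That constant must be controlled to first order
  as the exponent tends to 2. Interpolating the second moment
  between the moments of order \<open>2n / (n + 1)\<close> and 3 gives \<open>b powr (1 / n)\<close>, where \<open>b\<close> is the constant in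
  the inequality for third moments (\<open>Khinchine_powr\<close>). A convexity argument, which
  replaces random signs by Gaussians one at a time, shows that \<open>b\<close> may be taken to be the third
  absolute moment \<open>2 * sqrt (2 / \<pi>)\<close> of a standard Gaussian (\<open>third_moment_signs\<close>). As this is at most
  \<open>exp (1 / 2)\<close>, the product of the factors \<open>b powr (1 / k)\<close> for \<open>k < n\<close> is at most of order \<open>sqrt n\<close>.
\<close>

section \<open>Third moments of sums of random signs\<close>

lemma abs_cube_sum:
  fixes u z :: real
  shows "\<bar>u + z\<bar> ^ 3 + \<bar>u - z\<bar> ^ 3 =
    (if \<bar>z\<bar> \<le> \<bar>u\<bar> then 2 * \<bar>u\<bar> ^ 3 + 6 * \<bar>u\<bar> * \<bar>z\<bar>\<^sup>2 else 2 * \<bar>z\<bar> ^ 3 + 6 * \<bar>u\<bar>\<^sup>2 * \<bar>z\<bar>)"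
proof -
  have "\<bar>u + z\<bar> = \<bar>u\<bar> + \<bar>z\<bar> \<and> \<bar>u - z\<bar> = \<bar>\<bar>u\<bar> - \<bar>z\<bar>\<bar> \<or>
      \<bar>u - z\<bar> = \<bar>u\<bar> + \<bar>z\<bar> \<and> \<bar>u + z\<bar> = \<bar>\<bar>u\<bar> - \<bar>z\<bar>\<bar>"
    by arith
  then have "\<bar>u + z\<bar> ^ 3 + \<bar>u - z\<bar> ^ 3 = (\<bar>u\<bar> + \<bar>z\<bar>) ^ 3 + \<bar>\<bar>u\<bar> - \<bar>z\<bar>\<bar> ^ 3"
    by auto
  then show ?thesis
    by (simp add: abs_if[of "\<bar>u\<bar> - \<bar>z\<bar>"] power2_eq_square power3_eq_cube algebra_simps)
qed

text \<open>
  As a function of \<open>t = z\<^sup>2\<close>, the sum \<open>\<bar>u + z\<bar> ^ 3 + \<bar>u - z\<bar> ^ 3\<close> is affine up to \<open>t = u\<^sup>2\<close> and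
  convex from there on. The left-hand side is its tangent at \<open>t = a\<^sup>2\<close>, a point of the curved part.
\<close>

lemma cubic_tangent:
  fixes u z a :: real
  assumes "0 \<le> u" "0 \<le> z" "u \<le> a" "0 < a"
  shows "2 * a ^ 3 + 6 * u\<^sup>2 * a + 3 * (a + u\<^sup>2 / a) * (z\<^sup>2 - a\<^sup>2)
    \<le> (if z \<le> u then 2 * u ^ 3 + 6 * u * z\<^sup>2 else 2 * z ^ 3 + 6 * u\<^sup>2 * z)"
proof -
  have *: "2 * a ^ 3 + 6 * u\<^sup>2 * a + 3 * (a + u\<^sup>2 / a) * (z\<^sup>2 - a\<^sup>2) \<le> 2 * z ^ 3 + 6 * u\<^sup>2 * z"
    if "u \<le> z" for z
  proof -
    have "u * u \<le> z * a" "u * u \<le> a * a"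
      using that assms by (auto intro!: mult_mono)
    \<comment> \<open>Tangency makes \<open>z = a\<close> a double root of the difference of the two sides.\<close>
    then have "0 \<le> (z - a)\<^sup>2 * (2 * z * a + a * a - 3 * (u * u))"
      by (intro mult_nonneg_nonneg) auto
    also have "\<dots> = a * (2 * z ^ 3 + 6 * u\<^sup>2 * z
        - (2 * a ^ 3 + 6 * u\<^sup>2 * a + 3 * (a + u\<^sup>2 / a) * (z\<^sup>2 - a\<^sup>2)))"
      using \<open>0 < a\<close> by (simp add: field_simps power2_eq_square power3_eq_cube)
    finally show ?thesis
      using \<open>0 < a\<close> by (simp add: zero_le_mult_iff)
  qed
  show ?thesis
  proof (cases "z \<le> u")
    case True
    \<comment> \<open>On the affine part the slope of the function is at most that of the tangent, so the
      difference is smallest at the end point \<open>z = u\<close>, where the first case applies.\<close>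
    have "0 \<le> (a - u)\<^sup>2 / a" using \<open>0 < a\<close> by simp
    also have "\<dots> = a + u\<^sup>2 / a - 2 * u"
      using \<open>0 < a\<close> by (simp add: field_simps power2_eq_square)
    finally have "2 * u \<le> a + u\<^sup>2 / a" by simp
    moreover have "z\<^sup>2 \<le> u\<^sup>2" using True assms by (simp add: power_mono)
    ultimately have "3 * (2 * u) * (u\<^sup>2 - z\<^sup>2) \<le> 3 * (a + u\<^sup>2 / a) * (u\<^sup>2 - z\<^sup>2)"
      by (intro mult_right_mono) auto
    moreover have "3 * (a + u\<^sup>2 / a) * (z\<^sup>2 - a\<^sup>2)
        = 3 * (a + u\<^sup>2 / a) * (u\<^sup>2 - a\<^sup>2) - 3 * (a + u\<^sup>2 / a) * (u\<^sup>2 - z\<^sup>2)"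
      by (simp only: right_diff_distrib)
    moreover have "2 * u ^ 3 + 6 * u\<^sup>2 * u - 3 * (2 * u) * (u\<^sup>2 - z\<^sup>2) = 2 * u ^ 3 + 6 * u * z\<^sup>2"
      by (simp add: algebra_simps power2_eq_square)
    ultimately show ?thesis
      using *[of u] True by simp
  qed (use * in auto)
qed

text \<open>
  Supporting lines of the convex function \<open>z\<^sup>2 \<mapsto> \<bar>u + z\<bar> ^ 3 + \<bar>u - z\<bar> ^ 3\<close>. Written as an inequality
  that is linear in \<open>z\<^sup>2\<close>, it can be averaged over a random \<open>z\<close> of which only the variance is known;
  \<open>c \<ge> 0\<close> allows that variance to exceed \<open>a\<^sup>2\<close>.
\<close>

lemma abs_cube_sum_tangent:
  fixes u a :: real
  assumes "0 \<le> a"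
  obtains c where "0 \<le> c"
    "\<And>z. \<bar>u + a\<bar> ^ 3 + \<bar>u - a\<bar> ^ 3 + c * (z\<^sup>2 - a\<^sup>2) \<le> \<bar>u + z\<bar> ^ 3 + \<bar>u - z\<bar> ^ 3"
proof (cases "a \<le> \<bar>u\<bar>")
  case True
  show ?thesis
  proof (rule that[of "6 * \<bar>u\<bar>"])
    fix z
    have "2 * p ^ 3 + 6 * p * q\<^sup>2 \<le> 2 * q ^ 3 + 6 * p\<^sup>2 * q" if "p \<le> q" for p q :: real
    proof -
      have "0 \<le> (q - p) ^ 3" using that by simp
      then show ?thesis by (simp add: algebra_simps power2_eq_square power3_eq_cube)
    qed
    from this[of "\<bar>u\<bar>" "\<bar>z\<bar>"] show "\<bar>u + a\<bar> ^ 3 + \<bar>u - a\<bar> ^ 3 + 6 * \<bar>u\<bar> * (z\<^sup>2 - a\<^sup>2) \<le> \<bar>u + z\<bar> ^ 3 + \<bar>u - z\<bar> ^ 3"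
      using True assms unfolding abs_cube_sum by (auto simp: algebra_simps)
  qed auto
next
  case False
  show ?thesis
  proof (rule that[of "3 * (a + \<bar>u\<bar>\<^sup>2 / a)"])
    fix z
    show "\<bar>u + a\<bar> ^ 3 + \<bar>u - a\<bar> ^ 3 + 3 * (a + \<bar>u\<bar>\<^sup>2 / a) * (z\<^sup>2 - a\<^sup>2) \<le> \<bar>u + z\<bar> ^ 3 + \<bar>u - z\<bar> ^ 3"
      using cubic_tangent[of "\<bar>u\<bar>" "\<bar>z\<bar>" a] False assms unfolding abs_cube_sum by auto
  qed (use assms in auto)
qed

text \<open>
  The third absolute moment of a Gaussian with mean \<open>x\<close> and standard deviation \<open>\<sigma>\<close>, in the extended
  nonnegative reals so that Tonelli applies without integrability conditions.
\<close>

definition gauss_cube :: "real \<Rightarrow> real \<Rightarrow> ennreal" where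
  "gauss_cube \<sigma> x = (\<integral>\<^sup>+ y. ennreal (normal_density 0 \<sigma> y * \<bar>x + y\<bar> ^ 3) \<partial>lborel)"

lemma integrable_normal_density_times_cube:
  assumes "0 < \<sigma>"
  shows "integrable lborel (\<lambda>y. normal_density 0 \<sigma> y * \<bar>x + y\<bar> ^ 3)"
proof (rule Bochner_Integration.integrable_bound)
  show "integrable lborel (\<lambda>y. 4 * \<bar>x\<bar> ^ 3 * normal_density 0 \<sigma> y + 4 * (normal_density 0 \<sigma> y * \<bar>y\<bar> ^ 3))"
    using integrable_normal_moment_abs[OF assms, of 0 3] integrable_normal_density[OF assms, of 0]
    by (intro Bochner_Integration.integrable_add integrable_mult_right) auto
  have "\<bar>x + y\<bar> ^ 3 \<le> 4 * \<bar>x\<bar> ^ 3 + 4 * \<bar>y\<bar> ^ 3" for y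
  proof -
    have "\<bar>x + y\<bar> ^ 3 \<le> (\<bar>x\<bar> + \<bar>y\<bar>) ^ 3" by (intro power_mono) auto
    also have "\<dots> = 4 * \<bar>x\<bar> ^ 3 + 4 * \<bar>y\<bar> ^ 3 - 3 * ((\<bar>x\<bar> + \<bar>y\<bar>) * (\<bar>x\<bar> - \<bar>y\<bar>)\<^sup>2)"
      by (simp add: algebra_simps power2_eq_square power3_eq_cube)
    also have "\<dots> \<le> 4 * \<bar>x\<bar> ^ 3 + 4 * \<bar>y\<bar> ^ 3" by simp
    finally show ?thesis .
  qed
  from mult_left_mono[OF this normal_density_nonneg]
  show "AE y in lborel. norm (normal_density 0 \<sigma> y * \<bar>x + y\<bar> ^ 3)
      \<le> norm (4 * \<bar>x\<bar> ^ 3 * normal_density 0 \<sigma> y + 4 * (normal_density 0 \<sigma> y * \<bar>y\<bar> ^ 3))"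
    by (intro AE_I2) (simp add: algebra_simps abs_mult)
qed auto

lemma gauss_cube_eq_integral:
  assumes "0 < \<sigma>"
  shows "gauss_cube \<sigma> x = ennreal (\<integral>y. normal_density 0 \<sigma> y * \<bar>x + y\<bar> ^ 3 \<partial>lborel)"
  unfolding gauss_cube_def
  by (intro nn_integral_eq_integral integrable_normal_density_times_cube assms) auto

lemma gauss_cube_zero:
  assumes "0 < \<sigma>"
  shows "gauss_cube \<sigma> 0 = ennreal (2 * sqrt (2 / pi) * \<sigma> ^ 3)"
  using integral_normal_moment_abs_odd[OF assms, of 0 1] assms
  by (simp add: gauss_cube_eq_integral numeral_3_eq_3[symmetric] mult_ac)

text \<open>
  Averaging the supporting line at \<open>a\<^sup>2\<close> over a Gaussian: replacing the step \<open>\<plusminus>a\<close> by a centred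
  Gaussian of variance at least \<open>a\<^sup>2\<close> increases the third moment (Jensen's inequality). The case
  \<open>a = 0\<close> compares a point with a Gaussian around it.
\<close>

lemma two_point_le_gauss_cube:
  assumes "0 \<le> a" "a \<le> \<sigma>" "0 < \<sigma>"
  shows "ennreal (\<bar>x + a\<bar> ^ 3 + \<bar>x - a\<bar> ^ 3) \<le> 2 * gauss_cube \<sigma> x"
proof -
  let ?N = "normal_density 0 \<sigma>"
  obtain c where c: "0 \<le> c"
    "\<And>z. \<bar>x + a\<bar> ^ 3 + \<bar>x - a\<bar> ^ 3 + c * (z\<^sup>2 - a\<^sup>2) \<le> \<bar>x + z\<bar> ^ 3 + \<bar>x - z\<bar> ^ 3"
    using abs_cube_sum_tangent[OF \<open>0 \<le> a\<close>] by blast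
  let ?d = "\<bar>x + a\<bar> ^ 3 + \<bar>x - a\<bar> ^ 3 - c * a\<^sup>2"
  note int1 = integrable_normal_density_times_cube[OF \<open>0 < \<sigma>\<close>, of x]
  have sym: "?N (- z) = ?N z" for z by (simp add: normal_density_def)
  have int2: "integrable lborel (\<lambda>z. ?N z * \<bar>x - z\<bar> ^ 3)"
    and eq: "(\<integral>z. ?N z * \<bar>x - z\<bar> ^ 3 \<partial>lborel) = (\<integral>z. ?N z * \<bar>x + z\<bar> ^ 3 \<partial>lborel)"
    using lborel_integrable_real_affine[OF int1, of "-1" 0]
      lborel_integral_real_affine[of "-1" "\<lambda>z. ?N z * \<bar>x + z\<bar> ^ 3" 0]
    by (simp_all add: sym)
  have int3: "integrable lborel (\<lambda>z. ?d * ?N z)"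
    using integrable_normal_density[OF \<open>0 < \<sigma>\<close>, of 0] by auto
  have int4: "integrable lborel (\<lambda>z. c * (?N z * z\<^sup>2))"
    using integrable_normal_moment[OF \<open>0 < \<sigma>\<close>, of 0 2] by auto
  have "?d + c * \<sigma>\<^sup>2 = (\<integral>z. ?d * ?N z + c * (?N z * z\<^sup>2) \<partial>lborel)"
    using integral_normal_moment_even[OF \<open>0 < \<sigma>\<close>, of 0 1]
    by (subst Bochner_Integration.integral_add[OF int3 int4]) (simp add: \<open>0 < \<sigma>\<close> fact_numeral)
  also have "\<dots> \<le> (\<integral>z. ?N z * \<bar>x + z\<bar> ^ 3 + ?N z * \<bar>x - z\<bar> ^ 3 \<partial>lborel)"
  proof (rule integral_mono)
    fix z
    have "?N z * (?d + c * z\<^sup>2) \<le> ?N z * (\<bar>x + z\<bar> ^ 3 + \<bar>x - z\<bar> ^ 3)"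
      using c(2)[of z] by (intro mult_left_mono) (auto simp: algebra_simps)
    then show "?d * ?N z + c * (?N z * z\<^sup>2) \<le> ?N z * \<bar>x + z\<bar> ^ 3 + ?N z * \<bar>x - z\<bar> ^ 3"
      by (simp add: algebra_simps)
  qed (intro Bochner_Integration.integrable_add int1 int2 int3 int4)+
  also have "\<dots> = 2 * (\<integral>z. ?N z * \<bar>x + z\<bar> ^ 3 \<partial>lborel)"
    by (subst Bochner_Integration.integral_add[OF int1 int2]) (simp add: eq)
  finally have 1: "?d + c * \<sigma>\<^sup>2 \<le> 2 * (\<integral>z. ?N z * \<bar>x + z\<bar> ^ 3 \<partial>lborel)" .
  have "c * a\<^sup>2 \<le> c * \<sigma>\<^sup>2"
    using assms c by (intro mult_left_mono power_mono) auto
  with 1 have "\<bar>x + a\<bar> ^ 3 + \<bar>x - a\<bar> ^ 3 \<le> 2 * (\<integral>z. ?N z * \<bar>x + z\<bar> ^ 3 \<partial>lborel)" by linarith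
  from ennreal_leI[OF this] show ?thesis
    by (simp add: gauss_cube_eq_integral[OF \<open>0 < \<sigma>\<close>] ennreal_mult' )
qed

text \<open>
  The sum of independent centred Gaussians is Gaussian, with added variances.
\<close>

lemma gauss_cube_convolution:
  assumes "0 < \<sigma>" "0 < \<tau>"
  shows "(\<integral>\<^sup>+ y. ennreal (normal_density 0 \<tau> y) * gauss_cube \<sigma> (x + y) \<partial>lborel)
    = gauss_cube (sqrt (\<sigma>\<^sup>2 + \<tau>\<^sup>2)) x"
proof -
  have "(\<integral>\<^sup>+ y. ennreal (normal_density 0 \<tau> y) * gauss_cube \<sigma> (x + y) \<partial>lborel)
     = (\<integral>\<^sup>+ y. \<integral>\<^sup>+ w. ennreal (normal_density 0 \<sigma> (w - y) * normal_density 0 \<tau> y) * ennreal (\<bar>x + w\<bar> ^ 3) \<partial>lborel \<partial>lborel)"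
  proof (intro nn_integral_cong)
    fix y
    have "gauss_cube \<sigma> (x + y)
      = (\<integral>\<^sup>+ w. ennreal (normal_density 0 \<sigma> (w - y) * \<bar>x + w\<bar> ^ 3) \<partial>lborel)"
      unfolding gauss_cube_def
      by (subst nn_integral_real_affine[where c = 1 and t = "- y"]) (simp_all add: algebra_simps)
    then show "ennreal (normal_density 0 \<tau> y) * gauss_cube \<sigma> (x + y) =
      (\<integral>\<^sup>+ w. ennreal (normal_density 0 \<sigma> (w - y) * normal_density 0 \<tau> y) * ennreal (\<bar>x + w\<bar> ^ 3) \<partial>lborel)"
      by (simp add: nn_integral_cmult[symmetric] ennreal_mult'[symmetric] mult_ac)
  qed
  also have "\<dots> = (\<integral>\<^sup>+ w. \<integral>\<^sup>+ y. ennreal (normal_density 0 \<sigma> (w - y) * normal_density 0 \<tau> y) * ennreal (\<bar>x + w\<bar> ^ 3) \<partial>lborel \<partial>lborel)"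
    by (rule lborel_pair.Fubini') simp
  also have "\<dots> = (\<integral>\<^sup>+ w. ennreal (normal_density 0 (sqrt (\<sigma>\<^sup>2 + \<tau>\<^sup>2)) w) * ennreal (\<bar>x + w\<bar> ^ 3) \<partial>lborel)"
    by (intro nn_integral_cong, subst nn_integral_multc) (simp_all add: fun_cong[OF conv_normal_density_zero_mean[OF assms]])
  finally show ?thesis
    by (simp add: gauss_cube_def ennreal_mult')
qed

text \<open>
  The inductive step of the comparison with Gaussians: conditionally on a Gaussian part, a random sign
  with coefficient \<open>a\<close> may be replaced by an independent Gaussian of variance \<open>a\<^sup>2\<close>, which is then
  absorbed by convolution.
\<close>

lemma gauss_cube_two_point:
  assumes "0 < \<sigma>"
  shows "gauss_cube \<sigma> (x + a) + gauss_cube \<sigma> (x - a) \<le> 2 * gauss_cube (sqrt (\<sigma>\<^sup>2 + a\<^sup>2)) x"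
proof (cases "a = 0")
  case True
  with assms show ?thesis by (simp add: mult_2)
next
  case False
  have [measurable]: "gauss_cube \<bar>a\<bar> \<in> borel_measurable borel"
    unfolding gauss_cube_def by measurable
  have "gauss_cube \<sigma> (x + a) + gauss_cube \<sigma> (x - a)
     = (\<integral>\<^sup>+ y. ennreal (normal_density 0 \<sigma> y) * ennreal (\<bar>x + y + \<bar>a\<bar>\<bar> ^ 3 + \<bar>x + y - \<bar>a\<bar>\<bar> ^ 3) \<partial>lborel)"
    unfolding gauss_cube_def
    by (subst nn_integral_add[symmetric])
      (auto intro!: nn_integral_cong simp: ennreal_mult'[symmetric] ennreal_plus[symmetric]
        abs_if[of a] algebra_simps simp del: ennreal_plus)
  also have "\<dots> \<le> (\<integral>\<^sup>+ y. 2 * (ennreal (normal_density 0 \<sigma> y) * gauss_cube \<bar>a\<bar> (x + y)) \<partial>lborel)"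
  proof (rule nn_integral_mono)
    fix y
    have "ennreal (\<bar>x + y + \<bar>a\<bar>\<bar> ^ 3 + \<bar>x + y - \<bar>a\<bar>\<bar> ^ 3) \<le> 2 * gauss_cube \<bar>a\<bar> (x + y)"
      using False by (intro two_point_le_gauss_cube) auto
    from mult_left_mono[OF this, of "ennreal (normal_density 0 \<sigma> y)"]
    show "ennreal (normal_density 0 \<sigma> y) * ennreal (\<bar>x + y + \<bar>a\<bar>\<bar> ^ 3 + \<bar>x + y - \<bar>a\<bar>\<bar> ^ 3)
        \<le> 2 * (ennreal (normal_density 0 \<sigma> y) * gauss_cube \<bar>a\<bar> (x + y))"
      by (simp only: mult.left_commute[of 2]) simp
  qed
  also have "\<dots> = 2 * gauss_cube (sqrt (\<bar>a\<bar>\<^sup>2 + \<sigma>\<^sup>2)) x"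
    using False assms by (simp add: nn_integral_cmult gauss_cube_convolution del: power2_abs)
  finally show ?thesis by (simp add: add.commute)
qed

text \<open>
  Choices of signs on \<open>I\<close> are encoded by the subsets of \<open>I\<close>, so that an expectation over independent
  random signs is a sum over \<open>Pow I\<close> divided by \<open>2 ^ card I\<close>.
\<close>

definition rsign :: "'a set \<Rightarrow> 'a \<Rightarrow> real" where
  "rsign A i = (if i \<in> A then 1 else - 1)"

lemma sum_Pow_insert:
  assumes "finite J" "j \<notin> J"
  shows "(\<Sum>A\<in>Pow (insert j J). f A) = (\<Sum>A\<in>Pow J. f (insert j A) + f A)"
proof -
  have "(\<Sum>A\<in>Pow (insert j J). f A) = (\<Sum>A\<in>Pow J. f A) + (\<Sum>A\<in>insert j ` Pow J. f A)"
    unfolding Pow_insert using assms by (intro sum.union_disjoint) auto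
  also have "(\<Sum>A\<in>insert j ` Pow J. f A) = (\<Sum>A\<in>Pow J. f (insert j A))"
    using assms by (subst sum.reindex) (auto simp: inj_on_def)
  finally show ?thesis by (simp add: sum.distrib add.commute)
qed

lemma sum_sign_insert:
  assumes "finite J" "j \<notin> J" "A \<subseteq> J"
  shows "(\<Sum>i\<in>insert j J. rsign (insert j A) i * a i) = a j + (\<Sum>i\<in>J. rsign A i * a i)"
    and "(\<Sum>i\<in>insert j J. rsign A i * a i) = (\<Sum>i\<in>J. rsign A i * a i) - a j"
proof -
  have "(\<Sum>i\<in>J. rsign (insert j A) i * a i) = (\<Sum>i\<in>J. rsign A i * a i)"
    using assms by (intro sum.cong) (auto simp: rsign_def)
  then show "(\<Sum>i\<in>insert j J. rsign (insert j A) i * a i) = a j + (\<Sum>i\<in>J. rsign A i * a i)"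
    using assms by (simp add: rsign_def)
  show "(\<Sum>i\<in>insert j J. rsign A i * a i) = (\<Sum>i\<in>J. rsign A i * a i) - a j"
    using assms by (auto simp: rsign_def)
qed

lemma sum_signs_gauss_cube:
  fixes a :: "'a \<Rightarrow> real"
  assumes "finite I" "0 < \<sigma>"
  shows "(\<Sum>A\<in>Pow I. gauss_cube \<sigma> (x + (\<Sum>i\<in>I. rsign A i * a i)))
    \<le> 2 ^ card I * gauss_cube (sqrt (\<sigma>\<^sup>2 + (\<Sum>i\<in>I. (a i)\<^sup>2))) x"
  using assms(1)
proof (induction I arbitrary: x rule: finite_induct)
  case empty
  then show ?case using assms by simp
next
  case (insert j J)
  let ?s = "sqrt (\<sigma>\<^sup>2 + (\<Sum>i\<in>J. (a i)\<^sup>2))"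
  have "0 < ?s" using assms by (simp add: add_pos_nonneg sum_nonneg)
  have "(\<Sum>A\<in>Pow (insert j J). gauss_cube \<sigma> (x + (\<Sum>i\<in>insert j J. rsign A i * a i)))
    = (\<Sum>A\<in>Pow J. gauss_cube \<sigma> ((x + a j) + (\<Sum>i\<in>J. rsign A i * a i)))
      + (\<Sum>A\<in>Pow J. gauss_cube \<sigma> ((x - a j) + (\<Sum>i\<in>J. rsign A i * a i)))"
    unfolding sum_Pow_insert[OF insert.hyps] sum.distrib[symmetric]
    by (rule sum.cong) (auto simp only: sum_sign_insert[OF insert.hyps] Pow_iff
        add.assoc[symmetric] add_diff_eq diff_add_eq)
  also have "\<dots> \<le> 2 ^ card J * gauss_cube ?s (x + a j) + 2 ^ card J * gauss_cube ?s (x - a j)"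
    by (intro add_mono insert.IH)
  also have "\<dots> \<le> 2 ^ card J * (2 * gauss_cube (sqrt (?s\<^sup>2 + (a j)\<^sup>2)) x)"
    unfolding distrib_left[symmetric] using \<open>0 < ?s\<close>
    by (intro mult_left_mono gauss_cube_two_point) auto
  also have "?s\<^sup>2 + (a j)\<^sup>2 = \<sigma>\<^sup>2 + (\<Sum>i\<in>insert j J. (a i)\<^sup>2)"
    using insert.hyps by (simp add: sum_nonneg)
  finally show ?case
    using insert.hyps by (simp add: mult_ac)
qed

text \<open>
  Khinchine's inequality for the exponent 3 with the Gaussian constant: all signs are replaced by
  Gaussians one after the other.
\<close>

lemma third_moment_signs:
  fixes a :: "'a \<Rightarrow> real"
  assumes "finite I"
  shows "(\<Sum>A\<in>Pow I. \<bar>\<Sum>i\<in>I. rsign A i * a i\<bar> ^ 3)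
    \<le> 2 ^ card I * (2 * sqrt (2 / pi) * sqrt (\<Sum>i\<in>I. (a i)\<^sup>2) ^ 3)"
proof (rule tendsto_lowerbound)
  \<comment> \<open>A small Gaussian of standard deviation \<open>\<sigma>\<close> is added first, because \<open>normal_density 0 0\<close> is
    no density; at the end \<open>\<sigma>\<close> tends to 0.\<close>
  let ?S = "\<Sum>i\<in>I. (a i)\<^sup>2"
  let ?R = "\<lambda>\<sigma>. 2 ^ card I * (2 * sqrt (2 / pi) * sqrt (\<sigma>\<^sup>2 + ?S) ^ 3)"
  have "(?R \<longlongrightarrow> 2 ^ card I * (2 * sqrt (2 / pi) * sqrt (0\<^sup>2 + ?S) ^ 3)) (at_right 0)"
    by (intro tendsto_intros)
  then show "(?R \<longlongrightarrow> 2 ^ card I * (2 * sqrt (2 / pi) * sqrt ?S ^ 3)) (at_right 0)" by simp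
  show "\<forall>\<^sub>F \<sigma> in at_right 0. (\<Sum>A\<in>Pow I. \<bar>\<Sum>i\<in>I. rsign A i * a i\<bar> ^ 3) \<le> ?R \<sigma>"
  proof (rule eventually_at_rightI[of 0 1])
    fix \<sigma> :: real assume "\<sigma> \<in> {0<..<1}"
    then have "0 < \<sigma>" by simp
    then have pos: "0 < sqrt (\<sigma>\<^sup>2 + ?S)" by (simp add: add_pos_nonneg sum_nonneg)
    have "ennreal (\<bar>y\<bar> ^ 3) \<le> gauss_cube \<sigma> y" for y
    proof -
      have "ennreal 2 * ennreal (\<bar>y\<bar> ^ 3) \<le> 2 * gauss_cube \<sigma> y"
        using two_point_le_gauss_cube[of 0 \<sigma> y] \<open>0 < \<sigma>\<close>
        by (simp add: ennreal_mult'[symmetric] del: ennreal_numeral)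
      then show ?thesis by (simp add: ennreal_mult_le_mult_iff)
    qed
    then have "(\<Sum>A\<in>Pow I. ennreal (\<bar>\<Sum>i\<in>I. rsign A i * a i\<bar> ^ 3))
        \<le> (\<Sum>A\<in>Pow I. gauss_cube \<sigma> (0 + (\<Sum>i\<in>I. rsign A i * a i)))"
      unfolding add_0_left by (intro sum_mono)
    then have "ennreal (\<Sum>A\<in>Pow I. \<bar>\<Sum>i\<in>I. rsign A i * a i\<bar> ^ 3)
        \<le> (\<Sum>A\<in>Pow I. gauss_cube \<sigma> (0 + (\<Sum>i\<in>I. rsign A i * a i)))"
      by (simp only: sum_ennreal[OF zero_le_power[OF abs_ge_zero]])
    also have "\<dots> \<le> 2 ^ card I * gauss_cube (sqrt (\<sigma>\<^sup>2 + ?S)) 0"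
      by (rule sum_signs_gauss_cube[OF assms \<open>0 < \<sigma>\<close>])
    also have "\<dots> = ennreal (?R \<sigma>)"
      using pos by (simp add: gauss_cube_zero ennreal_mult' ennreal_power[symmetric] del: real_sqrt_gt_0_iff)
    finally show "(\<Sum>A\<in>Pow I. \<bar>\<Sum>i\<in>I. rsign A i * a i\<bar> ^ 3) \<le> ?R \<sigma>"
      by (subst (asm) ennreal_le_iff) (auto simp: sum_nonneg)
  qed simp
qed simp

section \<open>The inequalities of Hoelder and Minkowski for finite sums\<close>

lemma weighted_arith_geom_mean:
  fixes y w :: "'j \<Rightarrow> real"
  assumes "finite J" "\<And>j. j \<in> J \<Longrightarrow> 0 \<le> w j" "(\<Sum>j\<in>J. w j) = 1" "\<And>j. j \<in> J \<Longrightarrow> 0 \<le> y j"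
  shows "(\<Prod>j\<in>J. y j powr w j) \<le> (\<Sum>j\<in>J. w j * y j)"
proof (cases "\<exists>j\<in>J. y j = 0")
  case True
  then have "(\<Prod>j\<in>J. y j powr w j) = 0" using assms by (intro prod_zero) auto
  also have "0 \<le> (\<Sum>j\<in>J. w j * y j)" using assms by (intro sum_nonneg) auto
  finally show ?thesis .
next
  case False
  then have pos: "0 < y j" if "j \<in> J" for j using assms that by (simp add: less_le)
  have "(\<Prod>j\<in>J. y j powr w j) = exp (\<Sum>j\<in>J. w j *\<^sub>R ln (y j))"
    using False assms(1) by (auto simp: exp_sum powr_def intro!: prod.cong)
  also have "\<dots> \<le> (\<Sum>j\<in>J. w j * exp (ln (y j)))"
    using assms by (intro convex_on_sum[OF _ _ exp_convex]) auto
  also have "\<dots> = (\<Sum>j\<in>J. w j * y j)"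
    using pos by (intro sum.cong) auto
  finally show ?thesis .
qed

lemma Holder_sum:
  fixes f :: "'j \<Rightarrow> 'x \<Rightarrow> real"
  assumes "finite J" "\<And>j. j \<in> J \<Longrightarrow> 0 \<le> w j" "(\<Sum>j\<in>J. w j) = 1"
    and "finite X" "\<And>j x. j \<in> J \<Longrightarrow> x \<in> X \<Longrightarrow> 0 \<le> f j x"
  shows "(\<Sum>x\<in>X. \<Prod>j\<in>J. f j x powr w j) \<le> (\<Prod>j\<in>J. (\<Sum>x\<in>X. f j x) powr w j)"
proof (cases "\<exists>j\<in>J. (\<Sum>x\<in>X. f j x) = 0")
  case True
  then obtain j where j: "j \<in> J" "(\<Sum>x\<in>X. f j x) = 0" by auto
  then have "f j x = 0" if "x \<in> X" for x
    using assms that by (simp add: sum_nonneg_eq_0_iff)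
  with j have "(\<Prod>j\<in>J. f j x powr w j) = 0" if "x \<in> X" for x
    using assms(1) that by (intro prod_zero) auto
  then have "(\<Sum>x\<in>X. \<Prod>j\<in>J. f j x powr w j) = 0" by simp
  then show ?thesis by (simp add: prod_nonneg)
next
  case False
  define F where "F j = (\<Sum>x\<in>X. f j x)" for j
  have pos: "0 < F j" if "j \<in> J" for j
    using False that assms(5) by (auto simp: F_def less_le intro!: sum_nonneg)
  then have ne: "F j \<noteq> 0" if "j \<in> J" for j using that by fastforce
  let ?G = "\<Prod>j\<in>J. F j powr w j"
  have "(\<Sum>x\<in>X. \<Prod>j\<in>J. f j x powr w j) = ?G * (\<Sum>x\<in>X. \<Prod>j\<in>J. (f j x / F j) powr w j)"
    using pos assms(5)
    by (auto simp: sum_distrib_left prod.distrib[symmetric] powr_divide less_imp_le ne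
        intro!: sum.cong prod.cong)
  also have "\<dots> \<le> ?G * (\<Sum>x\<in>X. \<Sum>j\<in>J. w j * (f j x / F j))"
    using assms pos
    by (intro mult_left_mono sum_mono weighted_arith_geom_mean prod_nonneg)
      (auto intro!: divide_nonneg_pos)
  also have "(\<Sum>x\<in>X. \<Sum>j\<in>J. w j * (f j x / F j)) = (\<Sum>j\<in>J. w j * (F j / F j))"
    by (subst sum.swap) (simp only: F_def sum_distrib_left sum_divide_distrib)
  also have "\<dots> = (\<Sum>j\<in>J. w j)"
    using pos by (intro sum.cong) (auto simp: less_le)
  finally show ?thesis using assms by (simp add: F_def)
qed

lemma Holder_sum2:
  fixes f g :: "'x \<Rightarrow> real"
  assumes "0 \<le> \<alpha>" "0 \<le> \<beta>" "\<alpha> + \<beta> = 1" "finite X"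
    and "\<And>x. x \<in> X \<Longrightarrow> 0 \<le> f x" "\<And>x. x \<in> X \<Longrightarrow> 0 \<le> g x"
  shows "(\<Sum>x\<in>X. f x powr \<alpha> * g x powr \<beta>) \<le> (\<Sum>x\<in>X. f x) powr \<alpha> * (\<Sum>x\<in>X. g x) powr \<beta>"
  using Holder_sum[of UNIV "\<lambda>b. if b then \<alpha> else \<beta>" X "\<lambda>b. if b then f else g"] assms
  by (auto simp: UNIV_bool mult.commute add.commute)

text \<open>
  The triangle inequality of \<open>\<ell>\<^sub>r\<close>, by Hoelder's inequality applied to \<open>s ^ r = s * s ^ (r - 1)\<close>.
\<close>

lemma Minkowski_sum:
  fixes v :: "'x \<Rightarrow> 'i \<Rightarrow> real"
  assumes "1 < r" "finite X" "finite S" "\<And>x i. 0 \<le> v x i"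
  shows "(\<Sum>i\<in>S. (\<Sum>x\<in>X. v x i) powr r) powr (1 / r) \<le> (\<Sum>x\<in>X. (\<Sum>i\<in>S. v x i powr r) powr (1 / r))"
proof -
  define s where "s i = (\<Sum>x\<in>X. v x i)" for i
  define W where "W = (\<Sum>i\<in>S. s i powr r)"
  have s0: "0 \<le> s i" for i using assms by (simp add: s_def sum_nonneg)
  have W0: "0 \<le> W" by (simp add: W_def sum_nonneg)
  show ?thesis
  proof (cases "W = 0")
    case True
    then show ?thesis by (simp add: s_def W_def sum_nonneg)
  next
    case False
    have "W = (\<Sum>i\<in>S. s i * s i powr (r - 1))"
      unfolding W_def
    proof (rule sum.cong)
      fix i
      show "s i powr r = s i * s i powr (r - 1)"
        using s0[of i] powr_mult_base[OF s0[of i], of "r - 1"] by simp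
    qed simp
    also have "\<dots> = (\<Sum>x\<in>X. \<Sum>i\<in>S. v x i * s i powr (r - 1))"
      by (subst (1) s_def, subst sum.swap) (simp add: sum_distrib_right)
    also have "\<dots> = (\<Sum>x\<in>X. \<Sum>i\<in>S. (v x i powr r) powr (1 / r) * (s i powr r) powr (1 - 1 / r))"
      using assms s0 by (auto simp: powr_powr right_diff_distrib intro!: sum.cong)
    also have "\<dots> \<le> (\<Sum>x\<in>X. (\<Sum>i\<in>S. v x i powr r) powr (1 / r) * W powr (1 - 1 / r))"
      unfolding W_def using assms by (intro sum_mono Holder_sum2) auto
    also have "\<dots> = (\<Sum>x\<in>X. (\<Sum>i\<in>S. v x i powr r) powr (1 / r)) * W powr (1 - 1 / r)"
      by (simp add: sum_distrib_right)
    finally have *: "W powr (1 / r) * W powr (1 - 1 / r)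
        \<le> (\<Sum>x\<in>X. (\<Sum>i\<in>S. v x i powr r) powr (1 / r)) * W powr (1 - 1 / r)"
      using W0 by (simp add: powr_add[symmetric])
    show ?thesis
      using False W0 mult_right_le_imp_le[OF *] by (simp add: W_def s_def)
  qed
qed

section \<open>Khinchine's inequality below the exponent 2\<close>

lemma second_moment_signs:
  fixes a :: "'a \<Rightarrow> real"
  assumes "finite I"
  shows "(\<Sum>A\<in>Pow I. (x + (\<Sum>i\<in>I. rsign A i * a i))\<^sup>2) = 2 ^ card I * (x\<^sup>2 + (\<Sum>i\<in>I. (a i)\<^sup>2))"
  using assms
proof (induction I arbitrary: x rule: finite_induct)
  case (insert j J)
  have "(\<Sum>A\<in>Pow (insert j J). (x + (\<Sum>i\<in>insert j J. rsign A i * a i))\<^sup>2)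
    = (\<Sum>A\<in>Pow J. ((x + a j) + (\<Sum>i\<in>J. rsign A i * a i))\<^sup>2)
      + (\<Sum>A\<in>Pow J. ((x - a j) + (\<Sum>i\<in>J. rsign A i * a i))\<^sup>2)"
    unfolding sum_Pow_insert[OF insert.hyps] sum.distrib[symmetric]
    by (rule sum.cong) (auto simp only: sum_sign_insert[OF insert.hyps] Pow_iff
        add.assoc[symmetric] add_diff_eq diff_add_eq)
  then show ?case
    unfolding insert.IH using insert.hyps by (simp add: algebra_simps power2_eq_square)
qed simp

text \<open>
  Khinchine's inequality for the exponent \<open>p = 2n / (n + 1)\<close>, with a constant that is explicit and good
  for \<open>p\<close> near 2. It follows from the exponent 3 because the second moment lies between the
  \<open>p\<close>-th and the third one: \<open>E f\<^sup>2 \<le> (E \<bar>f\<bar> ^ p) ^ l * (E \<bar>f\<bar> ^ 3) ^ (1 - l)\<close>, where the value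
  \<open>l = (n + 1) / (n + 3)\<close> is determined by \<open>p l + 3 (1 - l) = 2\<close>.
\<close>

lemma Khinchine_powr:
  fixes a :: "'a \<Rightarrow> real" and n :: nat
  assumes "finite I" "1 \<le> n"
  shows "2 ^ card I * (\<Sum>i\<in>I. (a i)\<^sup>2) powr (real n / (real n + 1))
    \<le> (2 * sqrt (2 / pi)) powr (2 / (real n + 1))
      * (\<Sum>A\<in>Pow I. \<bar>\<Sum>i\<in>I. rsign A i * a i\<bar> powr (2 * real n / (real n + 1)))"
proof -
  define S where "S = (\<Sum>i\<in>I. (a i)\<^sup>2)"
  define F where "F A = \<bar>\<Sum>i\<in>I. rsign A i * a i\<bar>" for A
  define M where "M = (\<Sum>A\<in>Pow I. F A powr (2 * real n / (real n + 1)))"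
  define b where "b = 2 * sqrt (2 / pi)"
  define c where "c = (2::real) ^ card I"
  define l where "l = (real n + 1) / (real n + 3)"
  have l: "0 < l" "1 - l = 2 / (real n + 3)" by (simp_all add: l_def field_simps)
  have S0: "0 \<le> S" by (simp add: S_def sum_nonneg)
  have M0: "0 \<le> M" by (simp add: M_def sum_nonneg)
  have b0: "0 < b" by (simp add: b_def)
  have c0: "0 < c" by (simp add: c_def)
  have F0: "0 \<le> F A" for A by (simp add: F_def)
  have "c * S = (\<Sum>A\<in>Pow I. (F A)\<^sup>2)"
    using second_moment_signs[OF \<open>finite I\<close>, of 0 a] by (simp add: c_def S_def F_def)
  also have "\<dots> = (\<Sum>A\<in>Pow I. (F A powr (2 * real n / (real n + 1))) powr l * (F A ^ 3) powr (1 - l))"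
  proof (rule sum.cong)
    fix A
    show "(F A)\<^sup>2 = (F A powr (2 * real n / (real n + 1))) powr l * (F A ^ 3) powr (1 - l)"
    proof (cases "F A = 0")
      case False
      then have F: "0 < F A" using F0[of A] by simp
      have "2 * real n / (real n + 1) * l + 3 * (1 - l) = 2"
      proof -
        have "2 * real n / (real n + 1) * l + 3 * (1 - l) = 2 * real n / (real n + 3) + 6 / (real n + 3)"
          unfolding l by (simp add: l_def)
        also have "\<dots> = (2 * (real n + 3)) / (real n + 3)" by (simp add: add_divide_distrib[symmetric])
        also have "\<dots> = 2" by (subst nonzero_mult_div_cancel_right) auto
        finally show ?thesis .
      qed
      then have "F A powr (2 * real n / (real n + 1) * l + 3 * (1 - l)) = F A powr 2"
        by (simp only:)
      also have "\<dots> = (F A)\<^sup>2" using F by simp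
      finally have "F A powr (2 * real n / (real n + 1) * l + 3 * (1 - l)) = (F A)\<^sup>2" .
      then show ?thesis using F by (simp add: powr_powr powr_add powr_numeral[symmetric] del: powr_numeral)
    qed simp
  qed simp
  also have "\<dots> \<le> M powr l * (\<Sum>A\<in>Pow I. F A ^ 3) powr (1 - l)"
    unfolding M_def using assms l F0 by (intro Holder_sum2) auto
  also have "\<dots> \<le> M powr l * (c * (b * sqrt S ^ 3)) powr (1 - l)"
    using third_moment_signs[OF \<open>finite I\<close>, of a] l
    by (intro mult_left_mono powr_mono2) (auto simp: F_def b_def c_def S_def sum_nonneg)
  finally have *: "c * S \<le> M powr l * (c * (b * sqrt S ^ 3)) powr (1 - l)" .
  have "c * S powr (real n / (real n + 1)) \<le> b powr (2 / (real n + 1)) * M"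
  proof (cases "S = 0")
    case True
    then show ?thesis using M0 b0 by simp
  next
    case False
    with S0 have S: "0 < S" by simp
    have "sqrt S ^ 3 = S powr (3 / 2)"
      using S by (simp add: powr_half_sqrt[symmetric] powr_power)
    with * have "c * S \<le> M powr l * (c powr (1 - l) * (b powr (1 - l) * S powr (3 / 2 * (1 - l))))"
      using b0 c0 S by (simp add: powr_mult powr_powr)
    then have "(c * S) powr (1 / l)
        \<le> (M powr l * (c powr (1 - l) * (b powr (1 - l) * S powr (3 / 2 * (1 - l))))) powr (1 / l)"
      using c0 S l by (intro powr_mono2) auto
    also have "\<dots> = M * (c powr ((1 - l) / l) * (b powr ((1 - l) / l) * S powr (3 / 2 * ((1 - l) / l))))"
      using b0 c0 S l M0 by (simp add: powr_mult powr_powr)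
    also have "(1 - l) / l = 2 / (real n + 1)"
    proof -
      have "(2 / t) / (s / t) = 2 / s" if "t \<noteq> 0" for s t :: real using that by simp
      from this[of "real n + 3" "real n + 1"] show ?thesis unfolding l by (simp add: l_def)
    qed
    also have "1 / l = 1 + 2 / (real n + 1)"
      using add_divide_distrib[of "real n + 1" 2 "real n + 1"] by (simp add: l_def add.commute)
    finally have "c * c powr (2 / (real n + 1)) * S powr (1 + 2 / (real n + 1))
      \<le> M * (c powr (2 / (real n + 1)) * (b powr (2 / (real n + 1)) * S powr (3 / 2 * (2 / (real n + 1)))))"
      using c0 S by (simp add: powr_mult powr_add)
    then have "(c * S powr (1 + 2 / (real n + 1))) * c powr (2 / (real n + 1))
      \<le> (M * b powr (2 / (real n + 1)) * S powr (3 / 2 * (2 / (real n + 1)))) * c powr (2 / (real n + 1))"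
      by (simp add: mult_ac)
    from mult_right_le_imp_le[OF this]
    have 1: "c * S powr (1 + 2 / (real n + 1)) \<le> M * b powr (2 / (real n + 1)) * S powr (3 / 2 * (2 / (real n + 1)))"
      using c0 by simp
    have "1 + 2 / (real n + 1) = real n / (real n + 1) + 3 / 2 * (2 / (real n + 1))"
      using add_divide_distrib[of "real n + 1" 2 "real n + 1"] add_divide_distrib[of "real n" 3 "real n + 1"]
      by (simp add: add.commute)
    then have "S powr (1 + 2 / (real n + 1)) = S powr (real n / (real n + 1)) * S powr (3 / 2 * (2 / (real n + 1)))"
      by (simp only: powr_add)
    with 1 have "(c * S powr (real n / (real n + 1))) * S powr (3 / 2 * (2 / (real n + 1)))
       \<le> (b powr (2 / (real n + 1)) * M) * S powr (3 / 2 * (2 / (real n + 1)))"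
      by (simp only: mult_ac)
    from mult_right_le_imp_le[OF this] show ?thesis using S by simp
  qed
  then show ?thesis by (simp add: b_def c_def S_def M_def F_def)
qed

section \<open>Interpolation of mixed norms\<close>

text \<open>
  The iterated norm of the mixed \<open>\<ell>\<^sub>P\<close> space with exponent \<open>P k\<close> in the coordinate \<open>k\<close>; the head of the
  list is the outermost coordinate. The arguments of \<open>a\<close> are extensional functions on the set of
  coordinates, which explains \<open>\<lambda>_. undefined\<close> at the end of the recursion.
\<close>

fun mixed_norm :: "'i set \<Rightarrow> ('k \<Rightarrow> real) \<Rightarrow> 'k list \<Rightarrow> (('k \<Rightarrow> 'i) \<Rightarrow> real) \<Rightarrow> real" where
  "mixed_norm S P [] a = a (\<lambda>_. undefined)"
| "mixed_norm S P (k # ks) a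
    = (\<Sum>i\<in>S. mixed_norm S P ks (\<lambda>z. a (z(k := i))) powr P k) powr (1 / P k)"

lemma sum_PiE_insert:
  assumes "k \<notin> I"
  shows "(\<Sum>z\<in>insert k I \<rightarrow>\<^sub>E S. f z) = (\<Sum>i\<in>S. \<Sum>z\<in>I \<rightarrow>\<^sub>E S. f (z(k := i)))"
proof -
  have "(\<Sum>z\<in>insert k I \<rightarrow>\<^sub>E S. f z) = (\<Sum>(i, z)\<in>S \<times> (I \<rightarrow>\<^sub>E S). f (z(k := i)))"
    unfolding PiE_insert_eq using inj_combinator[OF assms, of "\<lambda>_. S"]
    by (subst sum.reindex) (auto simp: case_prod_unfold)
  then show ?thesis by (simp add: sum.cartesian_product)
qed

lemma mixed_norm_nonneg: "(\<And>z. 0 \<le> a z) \<Longrightarrow> 0 \<le> mixed_norm S P ks a"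
  by (cases ks) auto

lemma mixed_norm_const:
  assumes "distinct ks" "\<And>k. k \<in> set ks \<Longrightarrow> P k = p" "0 < p" "\<And>z. 0 \<le> a z"
  shows "mixed_norm S P ks a = (\<Sum>z\<in>set ks \<rightarrow>\<^sub>E S. a z powr p) powr (1 / p)"
  using assms
proof (induction ks arbitrary: a)
  case Nil
  then show ?case by (simp add: powr_powr)
next
  case (Cons k ks)
  have "mixed_norm S P ks (\<lambda>z. a (z(k := i))) powr p = (\<Sum>z\<in>set ks \<rightarrow>\<^sub>E S. a (z(k := i)) powr p)" for i
    using Cons.prems by (subst Cons.IH) (auto simp: powr_powr sum_nonneg)
  then show ?case using Cons.prems by (simp add: sum_PiE_insert)
qed

text \<open>
  Moving the summation with the larger exponent 2 from the place of \<open>j\<close> to the innermost place can only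
  increase the norm. This is the triangle inequality in \<open>\<ell>\<^sub>r\<close> with \<open>r = 2 / p\<close>, applied
  at the place of \<open>j\<close> in the list to the coordinates inside it.
\<close>

lemma mixed_norm_le_inner:
  assumes "distinct ks" "j \<in> set ks" "P j = 2" "\<And>k. k \<in> set ks \<Longrightarrow> k \<noteq> j \<Longrightarrow> P k = p"
    and "0 < p" "p < 2" "\<And>z. 0 \<le> a z" "finite S"
  shows "mixed_norm S P ks a powr p
    \<le> (\<Sum>z\<in>(set ks - {j}) \<rightarrow>\<^sub>E S. (\<Sum>i\<in>S. (a (z(j := i)))\<^sup>2) powr (p / 2))"
  using assms
proof (induction ks arbitrary: a)
  case Nil
  then show ?case by simp
next
  case (Cons k ks)
  show ?case
  proof (cases "k = j")
    case True
    then have j: "j \<notin> set ks" using Cons.prems by simp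
    have fin: "finite (set ks \<rightarrow>\<^sub>E S)" using Cons.prems by (intro finite_PiE) auto
    have "mixed_norm S P ks (\<lambda>z. a (z(j := i))) = (\<Sum>z\<in>set ks \<rightarrow>\<^sub>E S. a (z(j := i)) powr p) powr (1 / p)" for i
      using Cons.prems j True by (intro mixed_norm_const) auto
    then have "mixed_norm S P (k # ks) a powr p
      = (\<Sum>i\<in>S. (\<Sum>z\<in>set ks \<rightarrow>\<^sub>E S. a (z(j := i)) powr p) powr (2 / p)) powr (1 / (2 / p))"
      using Cons.prems True by (simp add: powr_powr sum_nonneg powr_numeral[symmetric] del: powr_numeral)
    also have "\<dots> \<le> (\<Sum>z\<in>set ks \<rightarrow>\<^sub>E S. (\<Sum>i\<in>S. (a (z(j := i)) powr p) powr (2 / p)) powr (1 / (2 / p)))"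
      using Cons.prems fin by (intro Minkowski_sum) auto
    also have "\<dots> = (\<Sum>z\<in>set ks \<rightarrow>\<^sub>E S. (\<Sum>i\<in>S. (a (z(j := i)))\<^sup>2) powr (p / 2))"
      using Cons.prems by (simp add: powr_powr)
    also have "set ks = set (k # ks) - {j}" using j True by auto
    finally show ?thesis .
  next
    case False
    then have "mixed_norm S P (k # ks) a powr p = (\<Sum>i\<in>S. mixed_norm S P ks (\<lambda>z. a (z(k := i))) powr p)"
      using Cons.prems by (simp add: powr_powr sum_nonneg)
    also have "\<dots> \<le> (\<Sum>i\<in>S. \<Sum>z\<in>(set ks - {j}) \<rightarrow>\<^sub>E S. (\<Sum>l\<in>S. (a (z(j := l, k := i)))\<^sup>2) powr (p / 2))"
      using Cons.prems False by (intro sum_mono Cons.IH) auto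
    also have "\<dots> = (\<Sum>i\<in>S. \<Sum>z\<in>(set ks - {j}) \<rightarrow>\<^sub>E S. (\<Sum>l\<in>S. (a (z(k := i, j := l)))\<^sup>2) powr (p / 2))"
      using False by (simp add: fun_upd_twist)
    also have "\<dots> = (\<Sum>z\<in>insert k (set ks - {j}) \<rightarrow>\<^sub>E S. (\<Sum>i\<in>S. (a (z(j := i)))\<^sup>2) powr (p / 2))"
      using Cons.prems by (subst sum_PiE_insert) auto
    also have "insert k (set ks - {j}) = set (k # ks) - {j}" using False by auto
    finally show ?thesis .
  qed
qed

text \<open>
  Interpolation of mixed norms: if the reciprocal exponents \<open>1 / Q\<close> are convex combinations of the
  \<open>1 / P j\<close>, with the same weights in every coordinate, then the norms are log-convex. Each
  coordinate uses Hoelder's inequality once.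
\<close>

lemma mixed_norm_Holder:
  assumes "finite J" "\<And>j. j \<in> J \<Longrightarrow> 0 < w j" "(\<Sum>j\<in>J. w j) = 1"
    and "\<And>j k. j \<in> J \<Longrightarrow> k \<in> set ks \<Longrightarrow> 0 < P j k"
    and "\<And>k. k \<in> set ks \<Longrightarrow> 0 < Q k" "\<And>k. k \<in> set ks \<Longrightarrow> (\<Sum>j\<in>J. w j / P j k) = 1 / Q k"
    and "finite S" "\<And>z. 0 \<le> a z"
  shows "mixed_norm S Q ks a \<le> (\<Prod>j\<in>J. mixed_norm S (P j) ks a powr w j)"
  using assms
proof (induction ks arbitrary: a)
  case Nil
  then have "J \<noteq> {}" by auto
  with Nil show ?case
    by (cases "a (\<lambda>_. undefined) = 0") (auto simp: powr_sum[symmetric])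
next
  case (Cons k ks)
  let ?m = "\<lambda>j i. mixed_norm S (P j) ks (\<lambda>z. a (z(k := i)))"
  let ?q = "Q k"
  have p: "0 < P j k" if "j \<in> J" for j using Cons.prems that by auto
  have q: "0 < ?q" using Cons.prems by auto
  have m0: "0 \<le> ?m j i" for j i using Cons.prems by (intro mixed_norm_nonneg) auto
  have wsum: "(\<Sum>j\<in>J. w j * ?q / P j k) = 1"
    using Cons.prems(6)[of k] q by (simp add: sum_distrib_right[symmetric] field_simps sum_divide_distrib[symmetric])
       (simp add: sum_distrib_left mult.commute)
  have "(\<Sum>i\<in>S. mixed_norm S Q ks (\<lambda>z. a (z(k := i))) powr ?q)
      \<le> (\<Sum>i\<in>S. (\<Prod>j\<in>J. ?m j i powr w j) powr ?q)"
    using less_imp_le[OF q] Cons.prems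
    by (intro sum_mono powr_mono2 Cons.IH mixed_norm_nonneg) (auto intro: less_imp_le)
  also have "\<dots> = (\<Sum>i\<in>S. \<Prod>j\<in>J. (?m j i powr P j k) powr (w j * ?q / P j k))"
    using p q by (auto simp: prod_powr_distrib powr_powr less_imp_neq[THEN not_sym] intro!: sum.cong prod.cong)
  also have "\<dots> \<le> (\<Prod>j\<in>J. (\<Sum>i\<in>S. ?m j i powr P j k) powr (w j * ?q / P j k))"
    using Cons.prems p q wsum by (intro Holder_sum) (auto intro!: divide_nonneg_pos mult_nonneg_nonneg less_imp_le)
  finally have "(\<Sum>i\<in>S. mixed_norm S Q ks (\<lambda>z. a (z(k := i))) powr ?q) powr (1 / ?q)
     \<le> (\<Prod>j\<in>J. (\<Sum>i\<in>S. ?m j i powr P j k) powr (w j * ?q / P j k)) powr (1 / ?q)"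
    using q by (intro powr_mono2) (auto simp: sum_nonneg)
  also have "\<dots> = (\<Prod>j\<in>J. ((\<Sum>i\<in>S. ?m j i powr P j k) powr (1 / P j k)) powr w j)"
    using q by (simp add: prod_powr_distrib powr_powr)
  finally show ?case by simp
qed

text \<open>
  A form of Blei's inequality. In each coordinate, averaging the reciprocals of the exponent 2 (used
  by one of the \<open>n + 1\<close> norms) and of \<open>p\<close> (used by the other \<open>n\<close>) gives
  \<open>(1 / 2 + n / p) / (n + 1) = (n + 2) / (2 (n + 1)) = 1 / q\<close>.
\<close>

lemma Blei_interpolation:
  fixes n :: nat and a :: "('k \<Rightarrow> 'i) \<Rightarrow> real"
  defines "p \<equiv> 2 * real n / (real n + 1)" and "q \<equiv> 2 * (real n + 1) / (real n + 2)"
  assumes "finite I" "card I = n + 1" "1 \<le> n" "finite S" "\<And>z. 0 \<le> a z" "0 \<le> T"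
    and T: "\<And>j. j \<in> I \<Longrightarrow>
      (\<Sum>z\<in>(I - {j}) \<rightarrow>\<^sub>E S. (\<Sum>i\<in>S. (a (z(j := i)))\<^sup>2) powr (p / 2)) \<le> T powr p"
  shows "(\<Sum>z\<in>I \<rightarrow>\<^sub>E S. a z powr q) \<le> T powr q"
proof -
  obtain ks where ks: "distinct ks" "set ks = I"
    using finite_distinct_list[OF \<open>finite I\<close>] by auto
  have p: "0 < p" "p < 2" using \<open>1 \<le> n\<close> by (auto simp: p_def field_simps)
  have q: "0 < q" by (simp add: q_def)
  define P where "P j k = (if k = j then 2 else p)" for j k :: 'k
  define w where "w = 1 / (real n + 1)"
  have bound: "mixed_norm S (P j) ks a \<le> T" if "j \<in> I" for j
  proof -
    have "mixed_norm S (P j) ks a powr p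
        \<le> (\<Sum>z\<in>(set ks - {j}) \<rightarrow>\<^sub>E S. (\<Sum>i\<in>S. (a (z(j := i)))\<^sup>2) powr (p / 2))"
      using ks that p assms by (intro mixed_norm_le_inner) (auto simp: P_def)
    also have "\<dots> \<le> T powr p" unfolding ks by (rule T[OF that])
    finally show ?thesis
      using p \<open>0 \<le> T\<close> powr_less_mono2[of p T "mixed_norm S (P j) ks a"] by (meson not_le)
  qed
  have "mixed_norm S (\<lambda>_. q) ks a \<le> (\<Prod>j\<in>I. mixed_norm S (P j) ks a powr w)"
  proof (rule mixed_norm_Holder)
    show "(\<Sum>j\<in>I. w / P j k) = 1 / q" if "k \<in> set ks" for k
    proof -
      have "(\<Sum>j\<in>I. w / P j k) = w / P k k + (\<Sum>j\<in>I - {k}. w / P j k)"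
        using that ks assms by (simp add: sum.remove)
      also have "(\<Sum>j\<in>I - {k}. w / P j k) = (\<Sum>j\<in>I - {k}. w / p)"
        by (intro sum.cong) (auto simp: P_def)
      also have "\<dots> = n * (w / p)" using that ks assms by simp
      finally show ?thesis using \<open>1 \<le> n\<close> by (simp add: P_def w_def p_def q_def field_simps)
    qed
  qed (use assms p q in \<open>auto simp: w_def P_def\<close>)
  also have "\<dots> \<le> (\<Prod>j\<in>I. T powr w)"
    using bound assms by (intro prod_mono conjI powr_mono2 mixed_norm_nonneg) (auto simp: w_def)
  also have "\<dots> = T"
  proof (cases "T = 0")
    case False
    then have "(\<Prod>j\<in>I. T powr w) = T powr (w * real (card I))"
      using \<open>0 \<le> T\<close> by (simp add: powr_power mult.commute)
    also have "w * real (card I) = 1" using assms by (simp add: w_def field_simps)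
    finally show ?thesis using \<open>0 \<le> T\<close> by simp
  qed (use assms in \<open>simp add: card_gt_0_iff\<close>)
  finally have "(\<Sum>z\<in>I \<rightarrow>\<^sub>E S. a z powr q) powr (1 / q) \<le> T"
    using ks q assms by (subst (asm) mixed_norm_const[where p = q]) auto
  then have "((\<Sum>z\<in>I \<rightarrow>\<^sub>E S. a z powr q) powr (1 / q)) powr q \<le> T powr q"
    using q by (intro powr_mono2) auto
  then show ?thesis using q by (simp add: powr_powr sum_nonneg)
qed

section \<open>The Bohnenblust--Hille inequality\<close>

text \<open>
  Multilinear forms whose slots are indexed by an arbitrary set \<open>I\<close>: fixing the argument in one slot
  again gives a form of this kind, without renumbering the slots.
\<close>

definition multilinear_on :: "nat set \<Rightarrow> nat \<Rightarrow> ((nat \<Rightarrow> real vec) \<Rightarrow> real) \<Rightarrow> bool" where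
  "multilinear_on I N U \<longleftrightarrow>
    (\<forall>z \<in> I \<rightarrow>\<^sub>E carrier_vec N. \<forall>k\<in>I. \<forall>v \<in> carrier_vec N.
      (\<forall>w \<in> carrier_vec N. U (z(k := v + w)) = U (z(k := v)) + U (z(k := w))) \<and>
      (\<forall>a. U (z(k := a \<cdot>\<^sub>v v)) = a * U (z(k := v))))"

lemma multilinear_form_iff: "multilinear_form n N U \<longleftrightarrow> multilinear_on {..<n} N U"
  by (auto simp: multilinear_on_def multilinear_form_def)

lemma multilinear_on_fix_slot:
  assumes "multilinear_on I N U" "j \<in> I" "s \<in> carrier_vec N"
  shows "multilinear_on (I - {j}) N (\<lambda>y. U (y(j := s)))"
  unfolding multilinear_on_def
proof (intro ballI)
  fix z :: "nat \<Rightarrow> real vec" and k and v :: "real vec"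
  assume z: "z \<in> (I - {j}) \<rightarrow>\<^sub>E carrier_vec N" and k: "k \<in> I - {j}" and v: "v \<in> carrier_vec N"
  have "z(j := s) \<in> I \<rightarrow>\<^sub>E carrier_vec N"
    using z assms by (auto simp: PiE_iff extensional_def)
  then show "(\<forall>w\<in>carrier_vec N. U (z(k := v + w, j := s)) = U (z(k := v, j := s)) + U (z(k := w, j := s))) \<and>
      (\<forall>a. U (z(k := a \<cdot>\<^sub>v v, j := s)) = a * U (z(k := v, j := s)))"
    using assms(1) k v unfolding multilinear_on_def by (auto simp: fun_upd_twist[of k j])
qed

lemma multilinear_on_expand_slot:
  assumes "multilinear_on I N U" "k \<in> I" "z \<in> (I - {k}) \<rightarrow>\<^sub>E carrier_vec N"
  shows "U (z(k := Matrix.vec N x)) = (\<Sum>i<N. x i * U (z(k := unit_vec N i)))"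
proof -
  define z0 where "z0 = z(k := 0\<^sub>v N)"
  have z0: "z0 \<in> I \<rightarrow>\<^sub>E carrier_vec N"
    using assms by (auto simp: z0_def PiE_iff extensional_def)
  have upd: "z(k := v) = z0(k := v)" for v by (simp add: z0_def)
  have add: "U (z(k := v + w)) = U (z(k := v)) + U (z(k := w))"
    if "v \<in> carrier_vec N" "w \<in> carrier_vec N" for v w
    using assms(1,2) z0 that unfolding upd multilinear_on_def by blast
  have scale: "U (z(k := a \<cdot>\<^sub>v v)) = a * U (z(k := v))" if "v \<in> carrier_vec N" for v a
    using assms(1,2) z0 that unfolding upd multilinear_on_def by blast
  have "U (z(k := Matrix.vec N (\<lambda>i. if i < r then x i else 0))) = (\<Sum>i<r. x i * U (z(k := unit_vec N i)))"
    if "r \<le> N" for r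
    using that
  proof (induction r)
    case 0
    have "Matrix.vec N (\<lambda>i. if i < 0 then x i else 0) = 0 \<cdot>\<^sub>v 0\<^sub>v N"
      by (intro eq_vecI) auto
    then show ?case by (simp only: scale[OF zero_carrier_vec]) simp
  next
    case (Suc r)
    have "Matrix.vec N (\<lambda>i. if i < Suc r then x i else 0)
      = Matrix.vec N (\<lambda>i. if i < r then x i else 0) + x r \<cdot>\<^sub>v unit_vec N r"
      using Suc.prems by (intro eq_vecI) (auto simp: less_Suc_eq)
    then have "U (z(k := Matrix.vec N (\<lambda>i. if i < Suc r then x i else 0)))
      = U (z(k := Matrix.vec N (\<lambda>i. if i < r then x i else 0))) + x r * U (z(k := unit_vec N r))"
      by (simp only: add[OF vec_carrier smult_carrier_vec[THEN iffD2, OF unit_vec_carrier]] scale[OF unit_vec_carrier])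
    then show ?case using Suc.IH Suc.prems by (simp only: sum.lessThan_Suc Suc_leD)
  qed
  from this[of N] have "U (z(k := Matrix.vec N (\<lambda>i. if i < N then x i else 0))) = (\<Sum>i<N. x i * U (z(k := unit_vec N i)))"
    by simp
  also have "Matrix.vec N (\<lambda>i. if i < N then x i else 0) = Matrix.vec N x"
    by (intro eq_vecI) auto
  finally show ?thesis .
qed

definition sign_vec :: "nat \<Rightarrow> nat set \<Rightarrow> real vec" where
  "sign_vec N A = Matrix.vec N (rsign A)"

lemma sign_vec_carrier [simp]: "sign_vec N A \<in> carrier_vec N"
  by (simp add: sign_vec_def)

definition basis_tuple :: "nat set \<Rightarrow> nat \<Rightarrow> (nat \<Rightarrow> nat) \<Rightarrow> nat \<Rightarrow> real vec" where
  "basis_tuple I N i = (\<lambda>k\<in>I. unit_vec N (i k))"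

lemma basis_tuple_upd:
  assumes "j \<in> I"
  shows "basis_tuple I N (z(j := i)) = (basis_tuple (I - {j}) N z)(j := unit_vec N i)"
  using assms by (auto simp: basis_tuple_def fun_eq_iff)

lemma basis_tuple_PiE: "basis_tuple I N z \<in> I \<rightarrow>\<^sub>E carrier_vec N"
  by (auto simp: basis_tuple_def)

text \<open>
  The left-hand side is the third absolute moment of a standard Gaussian; its square is \<open>8 / \<pi>\<close>, and
  \<open>8 / \<pi> < 8 / 3 < e\<close>. This numerical inequality is what yields the growth order \<open>sqrt n\<close> of the constants.
\<close>

lemma gauss_third_moment_le: "2 * sqrt (2 / pi) \<le> exp (1 / 2)"
proof -
  have "sin (pi / 6) \<le> pi / 6" by (rule sin_x_le_x) simp
  then have pi: "3 \<le> pi" by (simp add: sin_30)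
  have "(2 * sqrt (2 / pi))\<^sup>2 = 8 / pi" by (simp add: power_mult_distrib)
  also have "\<dots> \<le> 8 / 3" using pi by (intro divide_left_mono) auto
  also have "\<dots> \<le> (1 + 1 / real 32) ^ 32" by (simp add: power_divide)
  also have "\<dots> \<le> exp 1" by (rule exp_ge_one_plus_x_over_n_power_n) auto
  also have "exp 1 = (exp (1 / 2 :: real))\<^sup>2" by (simp add: exp_double[symmetric])
  finally show ?thesis by (rule power2_le_imp_le) simp
qed

text \<open>
  Bohnenblust--Hille by induction on the number of slots, for a form bounded by \<open>M\<close> on sign vectors.
  Fix a slot \<open>j\<close>. Khinchine's inequality in that slot bounds the square function along \<open>j\<close> by an average
  of \<open>p\<close>-th powers of the forms that arise when a random sign vector is put into the slot \<open>j\<close>, and \<open>p\<close> is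
  exactly the exponent of the inequality for one slot less. Interpolating between the estimates for
  the different \<open>j\<close> gives the inequality for all slots. The constant grows by the factor
  \<open>exp (1 / (2 n))\<close>, which accumulates to a harmonic number.
\<close>

lemma BH_on_sign_vectors:
  assumes "1 \<le> m" "finite I" "card I = m" "multilinear_on I N U"
    and "\<And>z. z \<in> I \<rightarrow>\<^sub>E range (sign_vec N) \<Longrightarrow> \<bar>U z\<bar> \<le> M"
  shows "(\<Sum>i\<in>I \<rightarrow>\<^sub>E {..<N}. \<bar>U (basis_tuple I N i)\<bar> powr (2 * real m / (real m + 1)))
    \<le> (exp (harm (m - 1) / 2) * M) powr (2 * real m / (real m + 1))"
  using assms
proof (induction m arbitrary: I U rule: nat_induct_at_least)
  case base
  then obtain j where I: "I = {j}" by (auto simp: card_1_singleton_iff)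
  let ?u = "\<lambda>i. U ((\<lambda>_. undefined)(j := unit_vec N i))"
  define A where "A = {i. 0 \<le> ?u i}"
  have "basis_tuple {j} N ((\<lambda>_. undefined)(j := i)) = (\<lambda>_. undefined)(j := unit_vec N i)" for i
    by (auto simp: basis_tuple_def fun_eq_iff)
  then have "(\<Sum>i\<in>I \<rightarrow>\<^sub>E {..<N}. \<bar>U (basis_tuple I N i)\<bar>) = (\<Sum>i<N. \<bar>?u i\<bar>)"
    unfolding I by (simp add: sum_PiE_insert)
  also have "\<dots> = (\<Sum>i<N. rsign A i * ?u i)"
    by (intro sum.cong) (auto simp: A_def rsign_def)
  also have "\<dots> = U ((\<lambda>_. undefined)(j := sign_vec N A))"
    unfolding sign_vec_def using base I by (subst multilinear_on_expand_slot[of I]) auto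
  also have "\<dots> \<le> \<bar>U ((\<lambda>_. undefined)(j := sign_vec N A))\<bar>" by simp
  also have "\<dots> \<le> M" by (rule base) (auto simp: I PiE_iff extensional_def)
  finally have "(\<Sum>i\<in>I \<rightarrow>\<^sub>E {..<N}. \<bar>U (basis_tuple I N i)\<bar>) \<le> M" .
  moreover from this have "0 \<le> M" by (rule order_trans[rotated]) (simp add: sum_nonneg)
  ultimately show ?case by (simp add: harm_def)
next
  case (Suc n)
  define p where "p = 2 * real n / (real n + 1)"
  define C where "C = exp (harm (n - 1) / 2) * M"
  have p: "0 < p" using \<open>1 \<le> n\<close> by (simp add: p_def)
  have "(\<lambda>k\<in>I. sign_vec N {}) \<in> I \<rightarrow>\<^sub>E range (sign_vec N)" by auto
  from Suc.prems(4)[OF this] have M0: "0 \<le> M" by linarith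
  have harm: "harm n = harm (n - 1) + 1 / real n"
    using \<open>1 \<le> n\<close> harm_Suc[of "n - 1", where 'a = real] by (simp add: divide_inverse)
  have T: "exp (harm n / 2) * M = exp (1 / (2 * real n)) * C"
    unfolding harm C_def by (simp add: add_divide_distrib exp_add)
  have "(\<Sum>z\<in>I \<rightarrow>\<^sub>E {..<N}. \<bar>U (basis_tuple I N z)\<bar> powr (2 * (real n + 1) / (real n + 2)))
      \<le> (exp (harm n / 2) * M) powr (2 * (real n + 1) / (real n + 2))"
  proof (rule Blei_interpolation)
    fix j assume j: "j \<in> I"
    define V where "V A y = U (y(j := sign_vec N A))" for A y
    have half: "2 * t / s / 2 = t / s" for s t :: real by simp
    let ?b = "basis_tuple (I - {j}) N"
    let ?D = "(2 * sqrt (2 / pi)) powr (2 / (real n + 1))"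
    have "V A (?b z) = (\<Sum>i<N. rsign A i * U (basis_tuple I N (z(j := i))))" for A z
      unfolding V_def sign_vec_def basis_tuple_upd[OF j]
      by (rule multilinear_on_expand_slot[OF Suc.prems(3) j basis_tuple_PiE])
    then have slice: "2 ^ N * (\<Sum>i<N. (U (basis_tuple I N (z(j := i))))\<^sup>2) powr (real n / (real n + 1))
        \<le> ?D * (\<Sum>A\<in>Pow {..<N}. \<bar>V A (?b z)\<bar> powr p)" for z
      using Khinchine_powr[of "{..<N}" n "\<lambda>i. U (basis_tuple I N (z(j := i)))"] \<open>1 \<le> n\<close>
      by (simp add: p_def)
    have IH: "(\<Sum>z\<in>(I - {j}) \<rightarrow>\<^sub>E {..<N}. \<bar>V A (?b z)\<bar> powr p) \<le> C powr p" for A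
      unfolding p_def C_def
    proof (rule Suc.IH)
      show "multilinear_on (I - {j}) N (V A)"
        unfolding V_def using Suc.prems j by (intro multilinear_on_fix_slot) auto
      fix z assume "z \<in> (I - {j}) \<rightarrow>\<^sub>E range (sign_vec N)"
      then have "z(j := sign_vec N A) \<in> I \<rightarrow>\<^sub>E range (sign_vec N)"
        using j by (auto simp: PiE_iff extensional_def)
      then show "\<bar>V A z\<bar> \<le> M" unfolding V_def by (rule Suc.prems(4))
    qed (use Suc.prems j in auto)
    have "2 ^ N * (\<Sum>z\<in>(I - {j}) \<rightarrow>\<^sub>E {..<N}.
        (\<Sum>i<N. (U (basis_tuple I N (z(j := i))))\<^sup>2) powr (real n / (real n + 1)))
      \<le> (\<Sum>z\<in>(I - {j}) \<rightarrow>\<^sub>E {..<N}. ?D * (\<Sum>A\<in>Pow {..<N}. \<bar>V A (?b z)\<bar> powr p))"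
      unfolding sum_distrib_left by (intro sum_mono slice[unfolded sum_distrib_left])
    also have "\<dots> = ?D * (\<Sum>A\<in>Pow {..<N}. \<Sum>z\<in>(I - {j}) \<rightarrow>\<^sub>E {..<N}. \<bar>V A (?b z)\<bar> powr p)"
      unfolding sum_distrib_left[symmetric] by (subst sum.swap) simp
    also have "\<dots> \<le> ?D * (\<Sum>A\<in>Pow {..<N}. C powr p)"
      by (intro mult_left_mono sum_mono IH) auto
    also have "\<dots> = 2 ^ N * (?D * C powr p)"
      by (simp add: card_Pow)
    also have "\<dots> \<le> 2 ^ N * (exp (1 / 2) powr (2 / (real n + 1)) * C powr p)"
      by (intro mult_left_mono mult_right_mono powr_mono2 gauss_third_moment_le) auto
    also have "exp (1 / 2) powr (2 / (real n + 1)) = exp (1 / (2 * real n)) powr p"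
      using \<open>1 \<le> n\<close> by (simp add: exp_powr_real p_def)
    also have "exp (1 / (2 * real n)) powr p * C powr p = (exp (harm n / 2) * M) powr p"
      unfolding T by (rule powr_mult[symmetric])
    finally have "(\<Sum>z\<in>(I - {j}) \<rightarrow>\<^sub>E {..<N}.
        (\<Sum>i<N. (U (basis_tuple I N (z(j := i))))\<^sup>2) powr (real n / (real n + 1)))
      \<le> (exp (harm n / 2) * M) powr p" by (rule mult_left_le_imp_le) simp
    then show "(\<Sum>z\<in>(I - {j}) \<rightarrow>\<^sub>E {..<N}.
        (\<Sum>i<N. (\<bar>U (basis_tuple I N (z(j := i)))\<bar>)\<^sup>2) powr (2 * real n / (real n + 1) / 2))
      \<le> (exp (harm n / 2) * M) powr (2 * real n / (real n + 1))"
      unfolding half power2_abs p_def .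
  qed (use Suc M0 in auto)
  then show ?case by (simp add: add_ac)
qed

lemma multilinear_on_insert_upd:
  assumes "multilinear_on (insert j J) N U" "j \<notin> J" "s \<in> carrier_vec N"
  shows "multilinear_on J N (\<lambda>y. U (y(j := s)))"
proof -
  have "insert j J - {j} = J" using assms(2) by auto
  with multilinear_on_fix_slot[OF assms(1) insertI1 assms(3)] show ?thesis by simp
qed

lemma PiE_insert_upd:
  assumes "z \<in> insert j J \<rightarrow>\<^sub>E S" "j \<notin> J"
  obtains y s where "y \<in> J \<rightarrow>\<^sub>E S" "s \<in> S" "z = y(j := s)"
  using assms by (auto simp: PiE_insert_eq)

lemma multilinear_on_homogeneous:
  assumes "finite I" "multilinear_on I N U" "z \<in> I \<rightarrow>\<^sub>E carrier_vec N"
  shows "U (\<lambda>k\<in>I. r \<cdot>\<^sub>v z k) = r ^ card I * U z"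
  using assms
proof (induction I arbitrary: U z rule: finite_induct)
  case empty
  then show ?case by (simp add: restrict_def)
next
  case (insert j J)
  obtain y s where y: "y \<in> J \<rightarrow>\<^sub>E carrier_vec N" "s \<in> carrier_vec N" and z: "z = y(j := s)"
    by (rule PiE_insert_upd[OF insert.prems(2) insert.hyps(2)])
  let ?y = "\<lambda>k\<in>J. r \<cdot>\<^sub>v y k"
  have "?y(j := s) \<in> insert j J \<rightarrow>\<^sub>E carrier_vec N"
    using y by (auto simp: PiE_iff extensional_def)
  then have "U ((?y(j := s))(j := r \<cdot>\<^sub>v s)) = r * U ((?y(j := s))(j := s))"
    using insert.prems(1) y unfolding multilinear_on_def by blast
  then have "U (?y(j := r \<cdot>\<^sub>v s)) = r * U (?y(j := s))"
    by (simp only: fun_upd_upd)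
  also have "U (?y(j := s)) = r ^ card J * U (y(j := s))"
    by (rule insert.IH[OF multilinear_on_insert_upd[OF insert.prems(1) insert.hyps(2) y(2)] y(1)])
  also have "?y(j := r \<cdot>\<^sub>v s) = (\<lambda>k\<in>insert j J. r \<cdot>\<^sub>v z k)"
    using insert.hyps by (auto simp: z fun_eq_iff)
  finally show ?case
    using insert.hyps by (simp add: z del: restrict_fupd)
qed

text \<open>
  Makes the supremum in the Bohnenblust--Hille inequality a true one: by default, the real-valued
  supremum of an unbounded set has no meaning.
\<close>

lemma multilinear_on_bounded:
  assumes "finite I" "multilinear_on I N U"
  shows "\<exists>B. \<forall>z \<in> I \<rightarrow>\<^sub>E {v \<in> carrier_vec N. \<forall>i<N. \<bar>vec_index v i\<bar> \<le> 1}. \<bar>U z\<bar> \<le> B"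
  using assms
proof (induction I arbitrary: U rule: finite_induct)
  case empty
  then show ?case by auto
next
  case (insert j J)
  let ?S = "{v \<in> carrier_vec N. \<forall>i<N. \<bar>vec_index v i\<bar> \<le> 1} :: real vec set"
  have "\<exists>B. \<forall>y \<in> J \<rightarrow>\<^sub>E ?S. \<bar>U (y(j := unit_vec N i))\<bar> \<le> B" for i
    using insert by (intro insert.IH multilinear_on_insert_upd) auto
  then have "\<forall>i. \<exists>B. \<forall>y \<in> J \<rightarrow>\<^sub>E ?S. \<bar>U (y(j := unit_vec N i))\<bar> \<le> B" by (rule allI)
  from choice[OF this] obtain B
    where B: "\<forall>i. \<forall>y \<in> J \<rightarrow>\<^sub>E ?S. \<bar>U (y(j := unit_vec N i))\<bar> \<le> B i" ..
  show ?case
  proof (intro exI ballI)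
    fix z assume zS: "z \<in> insert j J \<rightarrow>\<^sub>E ?S"
    obtain y s where y: "y \<in> J \<rightarrow>\<^sub>E ?S" "s \<in> ?S" and z: "z = y(j := s)"
      by (rule PiE_insert_upd[OF zS insert.hyps(2)])
    have s: "s = Matrix.vec N (vec_index s)" using y(2) by (intro eq_vecI) auto
    have "U (y(j := Matrix.vec N (vec_index s))) = (\<Sum>i<N. vec_index s i * U (y(j := unit_vec N i)))"
      using insert y by (intro multilinear_on_expand_slot[OF insert.prems]) (auto simp: PiE_iff)
    then have "\<bar>U z\<bar> = \<bar>\<Sum>i<N. vec_index s i * U (y(j := unit_vec N i))\<bar>"
      by (simp only: z s[symmetric])
    also have "\<dots> \<le> (\<Sum>i<N. \<bar>vec_index s i * U (y(j := unit_vec N i))\<bar>)"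
      by (rule sum_abs)
    also have "\<dots> \<le> (\<Sum>i<N. 1 * B i)"
      unfolding abs_mult using y B[rule_format, OF y(1)] by (intro sum_mono mult_mono) auto
    finally show "\<bar>U z\<bar> \<le> (\<Sum>i<N. 1 * B i)" .
  qed
qed

lemma open_unit_ball_iff:
  assumes "1 \<le> N"
  shows "v \<in> open_unit_ball N \<longleftrightarrow> v \<in> carrier_vec N \<and> (\<forall>i<N. \<bar>vec_index v i\<bar> < 1)"
proof -
  have "(\<lambda>i. \<bar>vec_index v i\<bar>) ` {..<N} \<noteq> {}" using assms by (auto simp: lessThan_empty_iff)
  then have "Max ((\<lambda>i. \<bar>vec_index v i\<bar>) ` {..<N}) < 1 \<longleftrightarrow> (\<forall>i<N. \<bar>vec_index v i\<bar> < 1)"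
    by (subst Max_less_iff) auto
  then show ?thesis
    unfolding open_unit_ball_def sup_norm_def using carrier_vecD[of v N] by blast
qed

lemma bdd_above_form_on_ball:
  assumes "multilinear_form n N U" "1 \<le> N"
  shows "bdd_above ((\<lambda>z. \<bar>U z\<bar>) ` ({..<n} \<rightarrow>\<^sub>E open_unit_ball N))"
proof -
  have "multilinear_on {..<n} N U" using assms(1) by (simp add: multilinear_form_iff)
  then obtain B where B: "\<And>z. z \<in> {..<n} \<rightarrow>\<^sub>E {v \<in> carrier_vec N. \<forall>i<N. \<bar>vec_index v i\<bar> \<le> 1} \<Longrightarrow> \<bar>U z\<bar> \<le> B"
    using multilinear_on_bounded[of "{..<n}" N U] by auto
  show ?thesis
    by (rule bdd_aboveI2[where M = B], rule B)
      (auto simp: PiE_iff open_unit_ball_iff[OF assms(2)] less_imp_le)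
qed

text \<open>
  Sign vectors lie on the boundary of the open unit ball, so the supremum over the ball bounds the form
  at their multiples by \<open>r < 1\<close>, and by homogeneity at the sign vectors themselves as \<open>r\<close> tends to 1.
\<close>

lemma BH_inequality_exp_harm:
  assumes "1 \<le> n"
  shows "BH_inequality n (exp (harm (n - 1) / 2))"
  unfolding BH_inequality_def
proof (intro allI impI)
  fix N U assume N: "1 \<le> (N::nat)" and U: "multilinear_form n N U"
  define M where "M = (SUP z \<in> {..<n} \<rightarrow>\<^sub>E open_unit_ball N. \<bar>U z\<bar>)"
  have U': "multilinear_on {..<n} N U" using U by (simp add: multilinear_form_iff)
  have bound: "\<bar>U z\<bar> \<le> M" if z: "z \<in> {..<n} \<rightarrow>\<^sub>E range (sign_vec N)" for z
  proof (rule tendsto_upperbound)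
    have z': "z \<in> {..<n} \<rightarrow>\<^sub>E carrier_vec N"
      using z by (rule rev_subsetD) (rule PiE_mono, auto)
    show "((\<lambda>r::real. r ^ n * \<bar>U z\<bar>) \<longlongrightarrow> \<bar>U z\<bar>) (at_left 1)"
      by (auto intro!: tendsto_eq_intros)
    show "\<forall>\<^sub>F r::real in at_left 1. r ^ n * \<bar>U z\<bar> \<le> M"
    proof (rule eventually_at_leftI[of 0])
      fix r :: real assume r: "r \<in> {0<..<1}"
      have "r \<cdot>\<^sub>v z k \<in> open_unit_ball N" if k: "k < n" for k
      proof -
        obtain A where A: "z k = sign_vec N A" using PiE_mem[OF z, of k] k by auto
        show ?thesis using r by (auto simp: open_unit_ball_iff[OF N] A sign_vec_def rsign_def)
      qed
      then have "(\<lambda>k\<in>{..<n}. r \<cdot>\<^sub>v z k) \<in> {..<n} \<rightarrow>\<^sub>E open_unit_ball N" by auto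
      then have "\<bar>U (\<lambda>k\<in>{..<n}. r \<cdot>\<^sub>v z k)\<bar> \<le> M"
        unfolding M_def by (rule cSUP_upper) (rule bdd_above_form_on_ball[OF U N])
      then show "r ^ n * \<bar>U z\<bar> \<le> M"
        using r by (simp add: multilinear_on_homogeneous[OF _ U' z'] abs_mult)
    qed simp
  qed simp
  have "(\<lambda>k\<in>{..<n}. sign_vec N {}) \<in> {..<n} \<rightarrow>\<^sub>E range (sign_vec N)" by auto
  from bound[OF this] have M0: "0 \<le> M" by linarith
  let ?q = "2 * real n / (real n + 1)"
  have q: "0 < ?q" "(real n + 1) / (2 * real n) = 1 / ?q" using assms by auto
  have "(\<Sum>i\<in>{..<n} \<rightarrow>\<^sub>E {..<N}. \<bar>U (basis_tuple {..<n} N i)\<bar> powr ?q)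
      \<le> (exp (harm (n - 1) / 2) * M) powr ?q"
    using bound assms U' by (intro BH_on_sign_vectors) auto
  then have "(\<Sum>i\<in>{..<n} \<rightarrow>\<^sub>E {..<N}. \<bar>U (basis_tuple {..<n} N i)\<bar> powr ?q) powr (1 / ?q)
      \<le> ((exp (harm (n - 1) / 2) * M) powr ?q) powr (1 / ?q)"
    using q by (intro powr_mono2) (auto simp: sum_nonneg)
  also have "\<dots> = exp (harm (n - 1) / 2) * M" using assms M0 by (simp add: powr_powr)
  finally show "(\<Sum>i \<in> {..<n} \<rightarrow>\<^sub>E {..<N}. \<bar>U (\<lambda>k\<in>{..<n}. unit_vec N (i k))\<bar> powr ?q)
        powr ((real n + 1) / (2 * real n))
      \<le> exp (harm (n - 1) / 2) * (SUP z \<in> {..<n} \<rightarrow>\<^sub>E open_unit_ball N. \<bar>U z\<bar>)"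
    unfolding q(2) M_def basis_tuple_def .
qed

section \<open>Growth and increments of the optimal constants\<close>

text \<open>
  The least constant exists as soon as some constant is admissible, because the inequality
  is preserved when passing to the infimum of the admissible constants.
\<close>

lemma BH_constant_bounds:
  assumes "1 \<le> C" "BH_inequality n C"
  shows "1 \<le> BH_constant n" "BH_constant n \<le> C"
proof -
  define S where "S = {C. 1 \<le> C \<and> BH_inequality n C}"
  have S: "C \<in> S" "S \<noteq> {}" "bdd_below S" using assms by (auto simp: S_def intro: bdd_belowI)
  have "BH_inequality n (Inf S)"
    unfolding BH_inequality_def
  proof (intro allI impI)
    fix N U assume NU: "1 \<le> (N::nat)" "multilinear_form n N U"
    let ?M = "SUP z \<in> {..<n} \<rightarrow>\<^sub>E open_unit_ball N. \<bar>U z\<bar>"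
    let ?L = "(\<Sum>i \<in> {..<n} \<rightarrow>\<^sub>E {..<N}.
          \<bar>U (\<lambda>k\<in>{..<n}. unit_vec N (i k))\<bar> powr (2 * real n / (real n + 1)))
        powr ((real n + 1) / (2 * real n))"
    have le: "?L \<le> D * ?M" if "D \<in> S" for D
      using that NU unfolding S_def BH_inequality_def by blast
    have "0 \<le> C * ?M" using le[OF S(1)] by (rule order_trans[rotated]) simp
    then have "0 \<le> ?M" using assms by (simp add: zero_le_mult_iff)
    show "?L \<le> Inf S * ?M"
    proof (cases "?M = 0")
      case True
      then show ?thesis using le[OF S(1)] by simp
    next
      case False
      with \<open>0 \<le> ?M\<close> have M: "0 < ?M" by simp
      have "?L / ?M \<le> Inf S"
        using S(2) by (rule cInf_greatest) (use le M in \<open>simp add: pos_divide_le_eq\<close>)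
      then show ?thesis using M by (simp add: pos_divide_le_eq)
    qed
  qed
  moreover have "1 \<le> Inf S" using S(2) by (rule cInf_greatest) (simp add: S_def)
  ultimately have "BH_constant n = Inf S"
    unfolding BH_constant_def using S(3)
    by (intro Least_equality) (auto simp: S_def intro: cInf_lower)
  then show "1 \<le> BH_constant n" "BH_constant n \<le> C"
    using \<open>1 \<le> Inf S\<close> cInf_lower[OF S(1,3)] by auto
qed

lemma BH_constant_growth:
  assumes "1 \<le> n"
  shows "1 \<le> BH_constant n" "BH_constant n \<le> exp (1 / 2) * sqrt (real n)"
proof -
  have 1: "1 \<le> exp (harm (n - 1) / (2::real))" by (simp add: harm_nonneg)
  note K = BH_constant_bounds[OF 1 BH_inequality_exp_harm[OF assms]]
  show "1 \<le> BH_constant n" by (rule K)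
  have "harm (n - 1) \<le> (harm n :: real)" by (rule harm_mono) simp
  also have "\<dots> \<le> 1 + ln (real n)"
    using decseq_harm_diff_ln assms decseqD[of _ 0 "n - 1"] by (fastforce simp: harm_def)
  finally have "exp (harm (n - 1) / 2) \<le> exp (1 / 2 + ln (real n) / 2)" by simp
  also have "\<dots> = exp (1 / 2) * sqrt (real n)"
    using assms by (simp add: exp_add ln_sqrt[symmetric])
  finally show "BH_constant n \<le> exp (1 / 2) * sqrt (real n)" using K by simp
qed

text \<open>
  If \<open>K (n + 1) - K n \<ge> c * n powr s\<close> for all large \<open>n\<close>, then adding these inequalities from \<open>n\<close> to \<open>2n - 1\<close>
  shows that \<open>K (2n)\<close> is at least of order \<open>n powr (s + 1)\<close>, which is impossible when \<open>s + 1 > 1 / 2\<close>.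
\<close>

lemma frequently_small_increment:
  fixes K :: "nat \<Rightarrow> real"
  assumes "0 < c" "- 1 / 2 < s"
    and nonneg: "\<And>n. 1 \<le> n \<Longrightarrow> 0 \<le> K n" and growth: "\<And>n. 1 \<le> n \<Longrightarrow> K n \<le> B * sqrt (real n)"
  shows "infinite {n. n \<ge> 1 \<and> K (n + 1) - K n < c * real n powr s}"
proof
  assume "finite {n. n \<ge> 1 \<and> K (n + 1) - K n < c * real n powr s}"
  then obtain n0 where n0: "\<And>n. n \<ge> 1 \<Longrightarrow> n \<ge> n0 \<Longrightarrow> c * real n powr s \<le> K (n + 1) - K n"
    unfolding finite_nat_set_iff_bounded by (auto simp: not_less) (meson not_less)
  \<comment> \<open>A nonpositive exponent makes \<open>j powr t\<close> decreasing, so that every summand is at least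
    the one at \<open>2n\<close>.\<close>
  define t where "t = min s 0"
  have t: "t \<le> 0" "t \<le> s" "0 < t + 1 / 2" using assms by (auto simp: t_def)
  have low: "c / 2 * real (2 * n) powr (t + 1 / 2) \<le> B" if n: "1 \<le> n" "n0 \<le> n" for n
  proof -
    have pos: "0 < real (2 * n)" using n by simp
    have "real n * (c * real (2 * n) powr t) = (\<Sum>j = n..<2 * n. c * real (2 * n) powr t)" by simp
    also have "\<dots> \<le> (\<Sum>j = n..<2 * n. K (Suc j) - K j)"
    proof (rule sum_mono)
      fix j assume j: "j \<in> {n..<2 * n}"
      have "real (2 * n) powr t \<le> real j powr t" using j n t by (intro powr_mono2') auto
      also have "\<dots> \<le> real j powr s" using j n t by (intro powr_mono) auto
      finally show "c * real (2 * n) powr t \<le> K (Suc j) - K j"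
        using n0[of j] j n \<open>0 < c\<close> by (smt (verit) Suc_eq_plus1 atLeastLessThan_iff le_trans mult_left_mono)
    qed
    also have "\<dots> = K (2 * n) - K n" by (rule sum_Suc_diff') simp
    also have "\<dots> \<le> B * sqrt (real (2 * n))" using nonneg[of n] growth[of "2 * n"] n by simp
    finally have *: "real n * (c * real (2 * n) powr t) \<le> B * sqrt (real (2 * n))" .
    have "real (2 * n) powr (t + 1 / 2) * sqrt (real (2 * n)) = real (2 * n) powr (t + 1)"
      using pos by (simp only: powr_half_sqrt[symmetric] powr_add[symmetric] less_imp_le) (simp add: add.commute)
    also have "\<dots> = real (2 * n) powr t * real (2 * n)" using pos by (simp only: powr_add) simp
    finally have "c / 2 * real (2 * n) powr (t + 1 / 2) * sqrt (real (2 * n)) = real n * (c * real (2 * n) powr t)"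
      by (simp add: mult.assoc)
    with * have "c / 2 * real (2 * n) powr (t + 1 / 2) * sqrt (real (2 * n)) \<le> B * sqrt (real (2 * n))"
      by (simp only:)
    then show ?thesis using pos by (simp only: mult_le_cancel_right) simp
  qed
  have "filterlim (\<lambda>n. c / 2 * real (2 * n) powr (t + 1 / 2)) at_top sequentially"
    using t(3) \<open>0 < c\<close> by real_asymp
  then have "\<forall>\<^sub>F n in sequentially. B < c / 2 * real (2 * n) powr (t + 1 / 2)"
    by (simp add: filterlim_at_top_dense)
  then have "\<forall>\<^sub>F n in sequentially. B < c / 2 * real (2 * n) powr (t + 1 / 2) \<and> 1 \<le> n \<and> n0 \<le> n"
    by (intro eventually_conj eventually_ge_at_top)
  then obtain n where "B < c / 2 * real (2 * n) powr (t + 1 / 2)" "1 \<le> n" "n0 \<le> n"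
    using eventually_happens trivial_limit_sequentially by blast
  with low[of n] show False by simp
qed

theorem theorem8p2:
  fixes \<epsilon> :: real
  assumes "\<epsilon> > 0"
  shows "infinite {n :: nat. n \<ge> 1 \<and>
    BH_constant (n + 1) - BH_constant n
      < (2 * sqrt 2 - 4 * exp (euler_mascheroni / 2 - 1))
        * real n powr (log 2 (2 powr (- 3 / 2) * exp (1 - euler_mascheroni / 2)) + \<epsilon>)}"
proof (rule frequently_small_increment)
  let ?g = "euler_mascheroni :: real"
  \<comment> \<open>Both the sign of the coefficient and the bound on the exponent reduce to
    \<open>\<gamma> < 2 - 2 * ln 2\<close>, which holds because \<open>13 / 22 < 2 - 2 * (25 / 36)\<close>.\<close>
  have ln2: "0 < ln (2::real)" "ln (2::real) \<le> 25 / 36" using ln2_le_25_over_36 by auto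
  have g: "?g < 13 / 22" by (rule euler_mascheroni_less_13_over_22)
  have "?g / 2 - 1 < - (ln 2 / 2)" using g ln2 by linarith
  then have "4 * exp (?g / 2 - 1) < 4 * exp (- (ln 2 / 2))" by simp
  also have "exp (- (ln 2 / 2)) = 1 / sqrt (2::real)"
    by (simp add: exp_minus ln_sqrt[symmetric] inverse_eq_divide)
  also have "4 * (1 / sqrt 2) = 2 * sqrt (2::real)" by (simp add: field_simps)
  finally show "0 < 2 * sqrt 2 - 4 * exp (?g / 2 - 1)" by simp
  have "log 2 (2 powr (- 3 / 2) * exp (1 - ?g / 2)) = - 3 / 2 + (1 - ?g / 2) / ln 2"
    by (simp add: log_mult log_def[of _ "exp _"])
  moreover have "ln 2 \<le> 1 - ?g / 2" using g ln2 by linarith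
  then have "1 \<le> (1 - ?g / 2) / ln 2" using ln2 by (simp add: pos_le_divide_eq)
  ultimately show "- 1 / 2 < log 2 (2 powr (- 3 / 2) * exp (1 - ?g / 2)) + \<epsilon>"
    using assms by linarith
qed (use BH_constant_growth order_trans[OF zero_le_one] in blast)+

end
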